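(* Let $m\ge 2$ be an integer and let $\underline{n}=(n_1,\dots,n_m)\in\mathbb{N}^m$ be a multi-index with all $n_i>0$. Then the Lie algebra $S(m,\underline{n})^{(1)}$ over $\mathbb{F}$ is not generated by 1,5 elements.
   Context: $\mathbb{F}$ is an algebraically closed field of characteristic $p>3$. A Lie algebra $L$ over $\mathbb{F}$ is generated by 1,5 elements if for every $x\in L$ with $x\ne 0$ there exists $y\in L$ such that the Lie subalgebra generated by $x$ and $y$ is $L$. Divided power algebra: for $m\ge1$, $\mathcal{O}(m)$ is the commutative $\mathbb{F}$-algebra with basis $x^{(\alpha)}$, $\alpha\in\mathbb{N}^m$ ($\mathbb N$ contains $0$), and product $x^{(\alpha)}x^{(\beta)}=\binom{\alpha+\beta}{\alpha}x^{(\alpha+\beta)}$, where $\binom{\alpha}{\beta}=\prod_i\binom{\alpha_i}{\beta_i}$. For $\underline{n}\in\mathbb{N}^m$ with all $n_i>0$, $\mathcal{O}(m,\underline{n})$ is the subalgebra spanned by the $x^{(\alpha)}$ with $0\le\alpha_i\le p^{n_i}-1$ for all $i$. For $1\le k\le m$, $\partial_k$ is the derivation of $\mathcal{O}(m,\underline{n})$ with $\partial_k(x^{(\alpha)})=x^{(\alpha-\epsilon_k)}$ (equal to $0$ if $\alpha_k=0$), where $\epsilon_k$ is the $k$-th unit multi-index. The Lie algebra of special derivations is $W(m,\underline{n})=\bigoplus_{k=1}^m\mathcal{O}(m,\underline{n})\,\partial_k\subseteq\operatorname{Der}\mathcal{O}(m,\underline{n})$. The divergence is $\operatorname{div}\big(\sum_{j=1}^m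 f_j\partial_j\big)=\sum_{j=1}^m\partial_j(f_j)\in\mathcal{O}(m,\underline{n})$. $S(m,\underline{n})$ is the Lie subalgebra $\{D\in W(m,\underline{n}) : \operatorname{div}(D)=0\}$, and $S(m,\underline{n})^{(1)}=[S(m,\underline{n}),S(m,\underline{n})]$ is its derived subalgebra. *)

theory Defs
  imports
    "HOL-Library.Cardinality"
    "HOL-Library.Function_Algebras"
    "HOL-Library.Poly_Mapping"
    "HOL-Computational_Algebra.Computational_Algebra"
begin

section \<open>Lie algebras\<close>

text \<open>
  Here \<open>s\<close> is the scalar multiplication and \<open>br\<close> the bracket of the ambient space; the bracket
  need only satisfy the Lie algebra axioms on the carriers to which these notions are applied.
\<close>

definition lie_subalgebra ::
  "('k::field \<Rightarrow> 'l::ab_group_add \<Rightarrow> 'l) \<Rightarrow> ('l \<Rightarrow> 'l \<Rightarrow> 'l) \<Rightarrow> 'l set \<Rightarrow> bool" where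
  "lie_subalgebra s br H \<longleftrightarrow> module.subspace s H \<and> (\<forall>x\<in>H. \<forall>y\<in>H. br x y \<in> H)"

definition lie_generated ::
  "('k::field \<Rightarrow> 'l::ab_group_add \<Rightarrow> 'l) \<Rightarrow> ('l \<Rightarrow> 'l \<Rightarrow> 'l) \<Rightarrow> 'l set \<Rightarrow> 'l set" where
  "lie_generated s br X = lie_subalgebra s br hull X"

definition lie_derived ::
  "('k::field \<Rightarrow> 'l::ab_group_add \<Rightarrow> 'l) \<Rightarrow> ('l \<Rightarrow> 'l \<Rightarrow> 'l) \<Rightarrow> 'l set \<Rightarrow> 'l set" where
  "lie_derived s br L = module.span s {br x y | x y. x \<in> L \<and> y \<in> L}"

definition one_and_half_generated ::
  "('k::field \<Rightarrow> 'l::ab_group_add \<Rightarrow> 'l) \<Rightarrow> ('l \<Rightarrow> 'l \<Rightarrow> 'l) \<Rightarrow> 'l set \<Rightarrow> bool" where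
  "one_and_half_generated s br L \<longleftrightarrow>
     (\<forall>x\<in>L. x \<noteq> 0 \<longrightarrow> (\<exists>y\<in>L. lie_generated s br {x, y} = L))"


section \<open>Divided power algebras\<close>

text \<open>
  The variables are indexed by a finite type \<open>'m\<close>, so that their number is \<open>CARD('m)\<close>. An element
  of the divided power algebra is the finitely supported family of its coefficients with respect
  to the basis of divided powers. The product is \<open>dp_mult\<close>; the multiplication \<open>(*)\<close> that the
  library puts on this type is the one of ordinary polynomials and is not used.
\<close>

type_synonym ('m, 'a) dp = "('m \<Rightarrow> nat) \<Rightarrow>\<^sub>0 'a"

definition dp_power :: "('m \<Rightarrow> nat) \<Rightarrow> ('m, 'a::field) dp" where
  "dp_power \<alpha> = Poly_Mapping.single \<alpha> 1"

definition dp_scale :: "'a::field \<Rightarrow> ('m, 'a) dp \<Rightarrow> ('m, 'a) dp" where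
  "dp_scale c f = Poly_Mapping.map (\<lambda>a. c * a) f"

definition multi_choose :: "('m::finite \<Rightarrow> nat) \<Rightarrow> ('m \<Rightarrow> nat) \<Rightarrow> nat" where
  "multi_choose \<alpha> \<beta> = (\<Prod>i\<in>UNIV. \<alpha> i choose \<beta> i)"

definition dp_mult :: "('m::finite, 'a::field) dp \<Rightarrow> ('m, 'a) dp \<Rightarrow> ('m, 'a) dp" where
  "dp_mult f g =
     (\<Sum>\<alpha>\<in>Poly_Mapping.keys f. \<Sum>\<beta>\<in>Poly_Mapping.keys g.
        dp_scale (Poly_Mapping.lookup f \<alpha> * Poly_Mapping.lookup g \<beta> *
                    of_nat (multi_choose (\<alpha> + \<beta>) \<alpha>))
          (dp_power (\<alpha> + \<beta>)))"

definition unit_index :: "'m \<Rightarrow> 'm \<Rightarrow> nat" where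
  "unit_index k = (\<lambda>i. if i = k then 1 else 0)"

text \<open>The linear map sending the basis element with index \<open>\<alpha>\<close> to the one with index
  \<open>\<alpha> - unit_index k\<close>, or to \<open>0\<close> if \<open>\<alpha> k = 0\<close>.\<close>

definition dp_deriv :: "'m \<Rightarrow> ('m, 'a::field) dp \<Rightarrow> ('m, 'a) dp" where
  "dp_deriv k f =
     (\<Sum>\<alpha>\<in>Poly_Mapping.keys f.
        if \<alpha> k = 0 then 0
        else dp_scale (Poly_Mapping.lookup f \<alpha>) (dp_power (\<alpha> - unit_index k)))"

lemma lookup_dp_scale [simp]:
  "Poly_Mapping.lookup (dp_scale c f) \<alpha> = c * Poly_Mapping.lookup f \<alpha>"
  by (simp add: dp_scale_def Poly_Mapping.map.rep_eq when_def)

interpretation dp: vector_space "dp_scale :: 'a::field \<Rightarrow> ('m, 'a) dp \<Rightarrow> ('m, 'a) dp"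
  by unfold_locales (auto intro!: poly_mapping_eqI simp: lookup_add algebra_simps)

definition dp_trunc :: "('m \<Rightarrow> nat) \<Rightarrow> ('m, 'a::field) dp set" where
  "dp_trunc n = dp.span {dp_power \<alpha> | \<alpha>. \<forall>i. \<alpha> i \<le> CHAR('a) ^ n i - 1}"


section \<open>Special derivations\<close>

text \<open>
  Linear operators on \<open>dp_trunc n\<close> are represented by total functions that vanish outside
  \<open>dp_trunc n\<close>, which makes equality of functions coincide with equality of operators.
\<close>

type_synonym ('m, 'a) dp_op = "('m, 'a) dp \<Rightarrow> ('m, 'a) dp"

definition op_scale :: "'a::field \<Rightarrow> ('m, 'a) dp_op \<Rightarrow> ('m, 'a) dp_op" where
  "op_scale c D = (\<lambda>h. dp_scale c (D h))"

definition op_bracket :: "('m, 'a::field) dp_op \<Rightarrow> ('m, 'a) dp_op \<Rightarrow> ('m, 'a) dp_op" where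
  "op_bracket D E = (\<lambda>h. D (E h) - E (D h))"

interpretation dp_op: vector_space "op_scale :: 'a::field \<Rightarrow> ('m, 'a) dp_op \<Rightarrow> ('m, 'a) dp_op"
  by unfold_locales
    (auto simp: op_scale_def fun_eq_iff dp.scale_right_distrib dp.scale_left_distrib)

definition special_der ::
  "('m \<Rightarrow> nat) \<Rightarrow> ('m::finite \<Rightarrow> ('m, 'a::field) dp) \<Rightarrow> ('m, 'a) dp_op" where
  "special_der n f =
     (\<lambda>h. if h \<in> dp_trunc n then \<Sum>k\<in>UNIV. dp_mult (f k) (dp_deriv k h) else 0)"

definition W_alg :: "('m::finite \<Rightarrow> nat) \<Rightarrow> ('m, 'a::field) dp_op set" where
  "W_alg n = {special_der n f | f. \<forall>k. f k \<in> dp_trunc n}"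

definition der_coeffs ::
  "('m::finite \<Rightarrow> nat) \<Rightarrow> ('m, 'a::field) dp_op \<Rightarrow> 'm \<Rightarrow> ('m, 'a) dp" where
  "der_coeffs n D = (THE f. (\<forall>k. f k \<in> dp_trunc n) \<and> D = special_der n f)"

definition divergence ::
  "('m::finite \<Rightarrow> nat) \<Rightarrow> ('m, 'a::field) dp_op \<Rightarrow> ('m, 'a) dp" where
  "divergence n D = (\<Sum>j\<in>UNIV. dp_deriv j (der_coeffs n D j))"

definition S_alg :: "('m::finite \<Rightarrow> nat) \<Rightarrow> ('m, 'a::field) dp_op set" where
  "S_alg n = {D \<in> W_alg n. divergence n D = 0}"

definition S_alg_derived :: "('m::finite \<Rightarrow> nat) \<Rightarrow> ('m, 'a::field) dp_op set" where
  "S_alg_derived n = lie_derived op_scale op_bracket (S_alg n)"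


subsection \<open>Basic computation rules\<close>

lemma keys_dp_power [simp]: "Poly_Mapping.keys (dp_power \<alpha> :: ('m, 'a::field) dp) = {\<alpha>}"
  by (simp add: dp_power_def)

lemma lookup_dp_power:
  "Poly_Mapping.lookup (dp_power \<alpha> :: ('m, 'a::field) dp) \<beta> = (if \<alpha> = \<beta> then 1 else 0)"
  by (simp add: dp_power_def lookup_single when_def)

lemma dp_expand:
  "(\<Sum>\<alpha>\<in>Poly_Mapping.keys f. dp_scale (Poly_Mapping.lookup f \<alpha>) (dp_power \<alpha>)) = f"
  by (rule poly_mapping_eqI)
    (simp add: lookup_sum lookup_dp_power if_distrib in_keys_iff cong: if_cong)

lemma dp_mult_power:
  "dp_mult (dp_power \<alpha>) (dp_power \<beta>) =
     dp_scale (of_nat (multi_choose (\<alpha> + \<beta>) \<alpha>)) (dp_power (\<alpha> + \<beta>) :: ('m::finite, 'a::field) dp)"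
  by (simp add: dp_mult_def lookup_dp_power)

lemma dp_deriv_power:
  "dp_deriv k (dp_power \<alpha> :: ('m, 'a::field) dp) =
     (if \<alpha> k = 0 then 0 else dp_power (\<alpha> - unit_index k))"
  by (simp add: dp_deriv_def lookup_dp_power)

lemma dp_mult_one [simp]: "dp_mult f (dp_power 0) = (f :: ('m::finite, 'a::field) dp)"
  by (simp add: dp_mult_def lookup_dp_power multi_choose_def dp_expand)

lemma dp_mult_zero [simp]: "dp_mult f 0 = (0 :: ('m::finite, 'a::field) dp)"
  by (simp add: dp_mult_def)

text \<open>The coefficients of a special derivation are its values at the variables.\<close>

lemma special_der_variable:
  fixes f :: "'m::finite \<Rightarrow> ('m, 'a::field) dp"
  assumes "CHAR('a) > 1" "\<And>i. n i > 0"
  shows "special_der n f (dp_power (unit_index j)) = f j"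
proof -
  have "CHAR('a) ^ n i > 1" for i
    using one_less_power[OF assms(1) assms(2)] .
  hence "\<forall>i. unit_index j i \<le> CHAR('a) ^ n i - 1"
    by (auto simp: unit_index_def Suc_le_eq)
  hence mem: "dp_power (unit_index j) \<in> (dp_trunc n :: ('m, 'a) dp set)"
    unfolding dp_trunc_def by (intro dp.span_base) blast
  have "dp_mult (f k) (dp_deriv k (dp_power (unit_index j))) = (if k = j then f j else 0)" for k
    by (auto simp: dp_deriv_power unit_index_def)
  with mem show ?thesis
    by (simp add: special_der_def)
qed

lemma divergence_special_der:
  fixes f :: "'m::finite \<Rightarrow> ('m, 'a::field) dp"
  assumes "CHAR('a) > 1" "\<And>i. n i > 0" "\<And>k. f k \<in> dp_trunc n"
  shows "divergence n (special_der n f) = (\<Sum>j\<in>UNIV. dp_deriv j (f j))"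
proof -
  have "der_coeffs n (special_der n f) = f"
    unfolding der_coeffs_def
  proof (rule the_equality)
    fix g assume "(\<forall>k. g k \<in> dp_trunc n) \<and> special_der n f = special_der n g"
    hence "special_der n f (dp_power (unit_index j)) = special_der n g (dp_power (unit_index j))" for j
      by simp
    thus "g = f"
      by (simp only: special_der_variable[OF assms(1,2)] fun_eq_iff) simp
  qed (use assms in auto)
  thus ?thesis
    by (simp add: divergence_def)
qed

end

theory Submission
  imports Defs
begin

text \<open>
  Write \<open>A\<close> for the truncated algebra, \<open>\<tau>\<close> for its top multi-index and \<open>\<integral>\<close> for the functional taking
  the coefficient of \<open>x\<^sup>\<tau>\<close>. Take for \<open>x\<close> the field \<open>x\<^bsup>(\<tau>-\<epsilon>\<^sub>j)\<^esup>\<partial>\<^sub>i - x\<^bsup>(\<tau>-\<epsilon>\<^sub>i)\<^esup>\<partial>\<^sub>j\<close> with \<open>i \<noteq> j\<close>, which has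
  the highest degree in the derived algebra. It annihilates every element of \<open>A\<close> that has no linear
  terms, because anything of degree at least two is pushed beyond \<open>\<tau>\<close>, up to two multiples of \<open>x\<^sup>\<tau>\<close>
  that cancel (lemma \<open>top_field_kills\<close>). So if a field \<open>y\<close> has a nonconstant invariant \<open>u \<in> A\<close> without
  linear terms, then \<open>x\<close>, \<open>y\<close> and all they generate annihilate \<open>u\<close>; but the derived algebra contains
  all \<open>\<partial>\<^sub>k\<close>, whose common kernel consists of the constants. The linear terms are no obstacle: if \<open>h\<close> is
  a nonconstant invariant vanishing at the origin, then either \<open>h\<^sup>2 \<noteq> 0\<close> and \<open>h\<^sup>2\<close> will do, or
  \<open>h\<^sup>2 = 0\<close>, which forces the linear part of \<open>h\<close> to vanish since the characteristic is not two.

  It remains to see that every \<open>y = \<Sum>\<^sub>k f\<^sub>k\<partial>\<^sub>k\<close> in the derived algebra has a nonconstant invariant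
  (lemma \<open>exists_nonconstant_invariant\<close>). Being in the derived algebra gives, besides
  \<open>div y = 0\<close>, the conditions \<open>\<integral> X\<^sub>i f\<^sub>i = 0\<close> with \<open>X\<^sub>i = x\<^sub>i\<^bsup>(\<tau>\<^sub>i)\<^esup>\<close>; in the language of differential forms,
  \<open>y\<close> pairs to zero with the classes of the closed forms \<open>X\<^sub>i dx\<^sub>i\<close>, which span the first de Rham
  cohomology of \<open>A\<close>. Suppose that only constants are invariant. Then the image of \<open>y\<close> has codimension
  one, so it is the kernel of \<open>\<integral>\<close>, and \<open>X\<^sub>i f\<^sub>i = y(g\<^sub>i)\<close> for some \<open>g\<^sub>i\<close>. The closed forms
  \<open>\<theta>\<^sub>i = X\<^sub>i dx\<^sub>i - dg\<^sub>i\<close> satisfy \<open>\<theta>\<^sub>i(y) = 0\<close> and are therefore invariant under the Lie derivative along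
  \<open>y\<close>. Their \<open>A\<close>-linear relations form a submodule of \<open>A\<^sup>m\<close> stable under \<open>y\<close>. If it were nonzero,
  it would contain a nonzero tuple of constants (lemma \<open>stable_submodule_contains_constant_tuple\<close>),
  making a combination of the \<open>X\<^sub>i dx\<^sub>i\<close> exact, which is impossible. So the \<open>\<theta>\<^sub>i\<close> are \<open>A\<close>-independent;
  there are \<open>m\<close> of them, so they form a basis of the 1-forms, and \<open>\<theta>\<^sub>i(y) = 0\<close> for all \<open>i\<close> gives
  \<open>y = 0\<close>. But then everything is invariant, a contradiction.
\<close>

section \<open>Injective endomorphisms of finite-dimensional subspaces\<close>

text \<open>
  The ambient spaces of divided powers are infinite-dimensional, so the dimension count is made
  inside a subspace: the image of a basis of \<open>V\<close> is an independent set of the same size in \<open>V\<close>.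
\<close>

lemma (in vector_space) linear_inj_imp_surj_on_subspace:
  assumes fin: "finite B" "V \<subseteq> span B" and V: "subspace V"
    and lin: "Vector_Spaces.linear scale scale f"
    and maps: "\<And>v. v \<in> V \<Longrightarrow> f v \<in> V"
    and inj: "\<And>v. v \<in> V \<Longrightarrow> f v = 0 \<Longrightarrow> v = 0"
    and w: "w \<in> V"
  shows "\<exists>v\<in>V. f v = w"
proof -
  interpret f: Vector_Spaces.linear scale scale f by fact
  obtain C where C: "C \<subseteq> V" "independent C" "V \<subseteq> span C"
    by (rule basis_exists)
  have span_C: "span C = V"
    using C V by (simp add: span_minimal subset_antisym)
  have finite_C: "finite C"
    using independent_span_bound[OF fin(1) C(2)] C(1) fin(2) by blast
  have inj_on: "inj_on f V"
  proof (rule inj_onI)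
    fix u v assume "u \<in> V" "v \<in> V" "f u = f v"
    thus "u = v"
      using inj[of "u - v"] by (simp add: f.diff subspace_diff[OF V])
  qed
  have indep: "independent (f ` C)"
    by (rule f.independent_injective_image[OF C(2)]) (use inj_on span_C in simp)
  have card: "card (f ` C) = card C"
    using inj_on C(1) by (intro card_image) (auto intro: inj_on_subset)
  have image: "f ` C \<subseteq> V"
    using maps C(1) by blast
  have "w \<in> span (f ` C)"
  proof (rule ccontr)
    assume w_notin: "w \<notin> span (f ` C)"
    hence "independent (insert w (f ` C))"
      using indep by (rule independent_insertI)
    moreover have "insert w (f ` C) \<subseteq> span C"
      using w image span_C by blast
    ultimately have "card (insert w (f ` C)) \<le> card C"
      using independent_span_bound[OF finite_C] by blast
    moreover have "w \<notin> f ` C"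
      using w_notin span_base by blast
    ultimately show False
      using finite_C card by simp
  qed
  also have "span (f ` C) = f ` V"
    by (simp add: f.span_image span_C)
  finally show ?thesis by blast
qed


section \<open>Arithmetic of divided powers\<close>

lemma finite_multi_indices_le: "finite {\<alpha>. \<alpha> \<le> (\<gamma> :: 'm::finite \<Rightarrow> nat)}"
proof (rule finite_subset)
  show "{\<alpha>. \<alpha> \<le> \<gamma>} \<subseteq> (\<Pi>\<^sub>E i\<in>UNIV. {..\<gamma> i})"
    by (auto simp: le_fun_def PiE_def)
qed (auto intro: finite_PiE)

lemma lookup_dp_deriv:
  "Poly_Mapping.lookup (dp_deriv k f) \<gamma> = Poly_Mapping.lookup f (\<gamma> + unit_index k)"
proof -
  have "Poly_Mapping.lookup (if \<alpha> k = 0 then 0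
          else dp_scale (Poly_Mapping.lookup f \<alpha>) (dp_power (\<alpha> - unit_index k))) \<gamma> =
        (if \<alpha> = \<gamma> + unit_index k then Poly_Mapping.lookup f \<alpha> else 0)" for \<alpha>
  proof -
    have "\<alpha> k \<noteq> 0 \<and> \<alpha> - unit_index k = \<gamma> \<longleftrightarrow> \<alpha> = \<gamma> + unit_index k"
      unfolding fun_eq_iff fun_diff_def plus_fun_def unit_index_def
      by (smt (verit) Nat.add_0_right Suc_eq_plus1 add_diff_cancel_right' diff_zero nat.simps(3) not0_implies_Suc)
    thus ?thesis
      by (auto simp: lookup_dp_power)
  qed
  thus ?thesis
    by (simp add: dp_deriv_def lookup_sum in_keys_iff)
qed

text \<open>
  The convolution formula: in this form bilinearity of the product is evident and single
  coefficients can be computed, neither of which the definition by double sums over supports offers.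
\<close>

lemma lookup_dp_mult:
  fixes f g :: "('m::finite, 'a::field) dp"
  shows "Poly_Mapping.lookup (dp_mult f g) \<gamma> =
    (\<Sum>\<alpha> | \<alpha> \<le> \<gamma>. Poly_Mapping.lookup f \<alpha> * Poly_Mapping.lookup g (\<gamma> - \<alpha>) *
       of_nat (multi_choose \<gamma> \<alpha>))"
proof -
  let ?t = "\<lambda>\<alpha>. Poly_Mapping.lookup f \<alpha> * Poly_Mapping.lookup g (\<gamma> - \<alpha>) *
       of_nat (multi_choose \<gamma> \<alpha>)"
  have iff: "\<alpha> + \<beta> = \<gamma> \<longleftrightarrow> \<alpha> \<le> \<gamma> \<and> \<beta> = \<gamma> - \<alpha>" for \<alpha> \<beta> :: "'m \<Rightarrow> nat"
    unfolding fun_eq_iff le_fun_def fun_diff_def plus_fun_def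
    by (metis add_diff_cancel_left' le_add1 le_add_diff_inverse)
  have inner: "(\<Sum>\<beta>\<in>Poly_Mapping.keys g. Poly_Mapping.lookup (dp_scale (Poly_Mapping.lookup f \<alpha> *
          Poly_Mapping.lookup g \<beta> * of_nat (multi_choose (\<alpha> + \<beta>) \<alpha>)) (dp_power (\<alpha> + \<beta>))) \<gamma>) =
        (if \<alpha> \<le> \<gamma> then ?t \<alpha> else 0)" for \<alpha>
  proof -
    have "(\<Sum>\<beta>\<in>Poly_Mapping.keys g. Poly_Mapping.lookup (dp_scale (Poly_Mapping.lookup f \<alpha> *
          Poly_Mapping.lookup g \<beta> * of_nat (multi_choose (\<alpha> + \<beta>) \<alpha>)) (dp_power (\<alpha> + \<beta>))) \<gamma>) =
      (\<Sum>\<beta>\<in>Poly_Mapping.keys g. if \<beta> = \<gamma> - \<alpha> then if \<alpha> \<le> \<gamma> then ?t \<alpha> else 0 else 0)"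
    proof (rule sum.cong[OF refl])
      fix \<beta> show "Poly_Mapping.lookup (dp_scale (Poly_Mapping.lookup f \<alpha> *
          Poly_Mapping.lookup g \<beta> * of_nat (multi_choose (\<alpha> + \<beta>) \<alpha>)) (dp_power (\<alpha> + \<beta>))) \<gamma> =
        (if \<beta> = \<gamma> - \<alpha> then if \<alpha> \<le> \<gamma> then ?t \<alpha> else 0 else 0)"
        using iff[of \<alpha> \<beta>] by (auto simp: lookup_dp_power)
    qed
    also have "\<dots> = (if \<alpha> \<le> \<gamma> then ?t \<alpha> else 0)"
      by (simp add: in_keys_iff)
    finally show ?thesis .
  qed
  have "Poly_Mapping.lookup (dp_mult f g) \<gamma> =
      (\<Sum>\<alpha>\<in>Poly_Mapping.keys f. if \<alpha> \<le> \<gamma> then ?t \<alpha> else 0)"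
    unfolding dp_mult_def lookup_sum inner ..
  also have "\<dots> = (\<Sum>\<alpha>\<in>Poly_Mapping.keys f \<inter> {\<alpha>. \<alpha> \<le> \<gamma>}. ?t \<alpha>)"
    by (simp add: sum.inter_restrict)
  also have "\<dots> = (\<Sum>\<alpha> | \<alpha> \<le> \<gamma>. ?t \<alpha>)"
    by (rule sum.mono_neutral_left) (auto simp: finite_multi_indices_le in_keys_iff)
  finally show ?thesis .
qed

lemma dp_linearI:
  fixes F :: "('m, 'a::field) dp \<Rightarrow> ('m, 'a) dp"
  assumes "\<And>f g. F (f + g) = F f + F g" "\<And>c f. F (dp_scale c f) = dp_scale c (F f)"
  shows "Vector_Spaces.linear dp_scale dp_scale F"
  by unfold_locales (fact assms)+

lemma linear_dp_mult_right: "Vector_Spaces.linear dp_scale dp_scale (dp_mult f)"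
  for f :: "('m::finite, 'a::field) dp"
  by (unfold_locales; intro poly_mapping_eqI)
    (simp_all add: lookup_dp_mult lookup_add sum.distrib sum_distrib_left algebra_simps)

lemma linear_dp_mult_left: "Vector_Spaces.linear dp_scale dp_scale (\<lambda>f. dp_mult f g)"
  for g :: "('m::finite, 'a::field) dp"
  by (unfold_locales; intro poly_mapping_eqI)
    (simp_all add: lookup_dp_mult lookup_add sum.distrib sum_distrib_left algebra_simps)

lemma linear_dp_deriv: "Vector_Spaces.linear dp_scale dp_scale (dp_deriv k)"
  by (unfold_locales; intro poly_mapping_eqI) (simp_all add: lookup_dp_deriv lookup_add)

interpretation dp_mult_right: Vector_Spaces.linear
  "dp_scale :: 'a::field \<Rightarrow> ('m::finite, 'a) dp \<Rightarrow> _" dp_scale "dp_mult f" for f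
  by (rule linear_dp_mult_right)

interpretation dp_mult_left: Vector_Spaces.linear
  "dp_scale :: 'a::field \<Rightarrow> ('m::finite, 'a) dp \<Rightarrow> _" dp_scale "\<lambda>f. dp_mult f g" for g
  by (rule linear_dp_mult_left)

interpretation dp_deriv: Vector_Spaces.linear
  "dp_scale :: 'a::field \<Rightarrow> ('m, 'a) dp \<Rightarrow> _" dp_scale "dp_deriv k" for k
  by (rule linear_dp_deriv)

lemmas dp_distrib =
  dp_mult_right.add dp_mult_right.diff dp_mult_right.sum dp_mult_right.scale dp_mult_right.neg
  dp_mult_left.add dp_mult_left.diff dp_mult_left.sum dp_mult_left.scale dp_mult_left.neg
  dp_deriv.add dp_deriv.diff dp_deriv.sum dp_deriv.scale dp_deriv.neg

lemma in_span_dp_powers: "f \<in> dp.span (dp_power ` Poly_Mapping.keys f)"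
proof -
  have "(\<Sum>\<alpha>\<in>Poly_Mapping.keys f. dp_scale (Poly_Mapping.lookup f \<alpha>) (dp_power \<alpha>))
      \<in> dp.span (dp_power ` Poly_Mapping.keys f)"
    by (intro dp.span_sum dp.span_scale dp.span_base) blast
  thus ?thesis by (simp only: dp_expand)
qed

interpretation dp_pair: vector_space_pair
  "dp_scale :: 'a::field \<Rightarrow> ('m, 'a) dp \<Rightarrow> _" "dp_scale :: 'a::field \<Rightarrow> ('m, 'a) dp \<Rightarrow> _"
  by unfold_locales

text \<open>
  Reduces identities between multilinear expressions to divided powers, one argument at a time.
\<close>

lemma linear_eq_on_dp_powers:
  fixes F G :: "('m, 'a::field) dp \<Rightarrow> ('m, 'a) dp"
  assumes "Vector_Spaces.linear dp_scale dp_scale F" "Vector_Spaces.linear dp_scale dp_scale G"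
    and "\<And>\<alpha>. \<alpha> \<in> Poly_Mapping.keys f \<Longrightarrow> F (dp_power \<alpha>) = G (dp_power \<alpha>)"
  shows "F f = G f"
  by (rule dp_pair.linear_eq_on[OF assms(1,2) in_span_dp_powers[of f]]) (use assms(3) in auto)

lemma multi_choose_commute: "multi_choose (\<alpha> + \<beta>) \<alpha> = multi_choose (\<alpha> + \<beta>) \<beta>"
  for \<alpha> \<beta> :: "'m::finite \<Rightarrow> nat"
  unfolding multi_choose_def plus_fun_def
  by (intro prod.cong refl) (metis add_diff_cancel_left' binomial_symmetric le_add1)

lemma dp_mult_commute: "dp_mult f g = dp_mult g f"
  for f g :: "('m::finite, 'a::field) dp"
proof (rule linear_eq_on_dp_powers[of "\<lambda>f. dp_mult f g" "\<lambda>f. dp_mult g f" f])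
  fix \<alpha> show "dp_mult (dp_power \<alpha>) g = dp_mult g (dp_power \<alpha>)"
  proof (rule linear_eq_on_dp_powers[OF linear_dp_mult_right linear_dp_mult_left])
    fix \<beta>
    show "dp_mult (dp_power \<alpha>) (dp_power \<beta>) = (dp_mult (dp_power \<beta>) (dp_power \<alpha>) :: ('m, 'a) dp)"
      unfolding dp_mult_power add.commute[of \<beta> \<alpha>] multi_choose_commute[of \<alpha> \<beta>] ..
  qed
qed (rule linear_dp_mult_left linear_dp_mult_right)+

lemma multi_choose_assoc:
  fixes \<alpha> \<beta> \<gamma> :: "'m::finite \<Rightarrow> nat"
  shows "multi_choose (\<alpha> + \<beta>) \<alpha> * multi_choose (\<alpha> + \<beta> + \<gamma>) (\<alpha> + \<beta>) =
         multi_choose (\<beta> + \<gamma>) \<beta> * multi_choose (\<alpha> + (\<beta> + \<gamma>)) \<alpha>"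
  unfolding multi_choose_def plus_fun_def prod.distrib[symmetric]
proof (intro prod.cong refl)
  fix i
  show "(\<alpha> i + \<beta> i choose \<alpha> i) * (\<alpha> i + \<beta> i + \<gamma> i choose (\<alpha> i + \<beta> i)) =
        (\<beta> i + \<gamma> i choose \<beta> i) * (\<alpha> i + (\<beta> i + \<gamma> i) choose \<alpha> i)"
    using choose_mult[of "\<alpha> i" "\<alpha> i + \<beta> i" "\<alpha> i + \<beta> i + \<gamma> i"]
    by (simp add: mult.commute add.assoc)
qed

lemma dp_mult_assoc: "dp_mult (dp_mult f g) h = dp_mult f (dp_mult g h)"
  for f g h :: "('m::finite, 'a::field) dp"
proof (rule linear_eq_on_dp_powers[of "\<lambda>f. dp_mult (dp_mult f g) h" "\<lambda>f. dp_mult f (dp_mult g h)" f])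
  fix \<alpha>
  show "dp_mult (dp_mult (dp_power \<alpha>) g) h = dp_mult (dp_power \<alpha>) (dp_mult g h)"
  proof (rule linear_eq_on_dp_powers[of "\<lambda>g. dp_mult (dp_mult (dp_power \<alpha>) g) h"
        "\<lambda>g. dp_mult (dp_power \<alpha>) (dp_mult g h)" g])
    fix \<beta>
    show "dp_mult (dp_mult (dp_power \<alpha>) (dp_power \<beta>)) h =
          dp_mult (dp_power \<alpha>) (dp_mult (dp_power \<beta>) h)"
    proof (rule linear_eq_on_dp_powers[of "dp_mult (dp_mult (dp_power \<alpha>) (dp_power \<beta>))"
          "\<lambda>h. dp_mult (dp_power \<alpha>) (dp_mult (dp_power \<beta>) h)" h])
      fix \<gamma>
      show "dp_mult (dp_mult (dp_power \<alpha>) (dp_power \<beta>)) (dp_power \<gamma>) =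
            dp_mult (dp_power \<alpha>) (dp_mult (dp_power \<beta>) (dp_power \<gamma>) :: ('m, 'a) dp)"
        using multi_choose_assoc[of \<alpha> \<beta> \<gamma>, THEN arg_cong[where f = "of_nat :: nat \<Rightarrow> 'a"]]
        by (simp add: dp_mult_power dp_distrib add.assoc)
    qed (rule dp_linearI; simp add: dp_distrib)+
  qed (rule dp_linearI; simp add: dp_distrib)+
qed (rule dp_linearI; simp add: dp_distrib)+

lemma dp_mult_left_commute: "dp_mult f (dp_mult g h) = dp_mult g (dp_mult f h)"
  for f g h :: "('m::finite, 'a::field) dp"
  by (subst (1 2) dp_mult_assoc[symmetric]) (simp only: dp_mult_commute[of f g])

lemmas dp_mult_ac = dp_mult_assoc dp_mult_commute dp_mult_left_commute

lemma dp_one_mult [simp]: "dp_mult (dp_power 0) f = (f :: ('m::finite, 'a::field) dp)"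
  by (simp add: dp_mult_commute[of "dp_power 0"])

lemma dp_deriv_commute: "dp_deriv k (dp_deriv l f) = dp_deriv l (dp_deriv k f)"
  by (rule poly_mapping_eqI) (simp add: lookup_dp_deriv add_ac)

lemma multi_choose_pascal:
  fixes \<alpha> \<beta> :: "'m::finite \<Rightarrow> nat"
  shows "multi_choose (\<alpha> + \<beta> + unit_index k + unit_index k) (\<alpha> + unit_index k) =
         multi_choose (\<alpha> + \<beta> + unit_index k) \<alpha> + multi_choose (\<alpha> + \<beta> + unit_index k) (\<alpha> + unit_index k)"
proof -
  have split: "multi_choose \<gamma> \<delta> = (\<gamma> k choose \<delta> k) * (\<Prod>i\<in>-{k}. \<gamma> i choose \<delta> i)"
    for \<gamma> \<delta> :: "'m \<Rightarrow> nat"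
    unfolding multi_choose_def Compl_eq_Diff_UNIV by (simp add: prod.remove[of UNIV k])
  show ?thesis
    unfolding split by (simp add: unit_index_def algebra_simps)
qed

lemma dp_deriv_mult:
  fixes f g :: "('m::finite, 'a::field) dp"
  shows "dp_deriv k (dp_mult f g) = dp_mult (dp_deriv k f) g + dp_mult f (dp_deriv k g)"
proof (rule linear_eq_on_dp_powers[of "\<lambda>f. dp_deriv k (dp_mult f g)"
      "\<lambda>f. dp_mult (dp_deriv k f) g + dp_mult f (dp_deriv k g)" f])
  fix \<alpha>
  show "dp_deriv k (dp_mult (dp_power \<alpha>) g) =
      dp_mult (dp_deriv k (dp_power \<alpha>)) g + dp_mult (dp_power \<alpha>) (dp_deriv k g)"
  proof (rule linear_eq_on_dp_powers[of "\<lambda>g. dp_deriv k (dp_mult (dp_power \<alpha>) g)"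
        "\<lambda>g. dp_mult (dp_deriv k (dp_power \<alpha>)) g + dp_mult (dp_power \<alpha>) (dp_deriv k g)" g])
    fix \<beta> :: "'m \<Rightarrow> nat"
    have shift: "\<delta> = (\<delta> - unit_index k) + unit_index k" if "\<delta> k \<noteq> 0" for \<delta> :: "'m \<Rightarrow> nat"
      using that by (auto simp: fun_eq_iff unit_index_def)
    have cancel: "\<delta> + unit_index k - unit_index k = \<delta>" for \<delta> :: "'m \<Rightarrow> nat"
      by (auto simp: fun_eq_iff)
    have at_k: "unit_index k k = 1" by (simp add: unit_index_def)
    show "dp_deriv k (dp_mult (dp_power \<alpha>) (dp_power \<beta>)) =
        dp_mult (dp_deriv k (dp_power \<alpha>)) (dp_power \<beta>) +
        dp_mult (dp_power \<alpha>) (dp_deriv k (dp_power \<beta>) :: ('m, 'a) dp)"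
    proof (cases "\<alpha> k = 0")
      case \<alpha>0: True
      show ?thesis
      proof (cases "\<beta> k = 0")
        case True
        with \<alpha>0 show ?thesis by (simp add: dp_mult_power dp_deriv_power dp_distrib)
      next
        case False
        then obtain \<beta>' where \<beta>: "\<beta> = \<beta>' + unit_index k" using shift by blast
        have "multi_choose (\<alpha> + \<beta>) \<alpha> = multi_choose (\<alpha> + \<beta>') \<alpha>"
          unfolding multi_choose_def \<beta>
          by (intro prod.cong refl) (use \<alpha>0 in \<open>auto simp: unit_index_def\<close>)
        with \<alpha>0 \<beta> show ?thesis
          by (simp add: dp_mult_power dp_deriv_power dp_distrib at_k cancel flip: add.assoc)
      qed
    next
      case False
      then obtain \<alpha>' where \<alpha>: "\<alpha> = \<alpha>' + unit_index k" using shift by blast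
      show ?thesis
      proof (cases "\<beta> k = 0")
        case True
        have "multi_choose (\<alpha> + \<beta>) \<beta> = multi_choose (\<alpha>' + \<beta>) \<beta>"
          unfolding multi_choose_def \<alpha>
          by (intro prod.cong refl) (use True in \<open>auto simp: unit_index_def\<close>)
        hence "multi_choose (\<alpha> + \<beta>) \<alpha> = multi_choose (\<alpha>' + \<beta>) \<alpha>'"
          by (metis add.commute multi_choose_commute)
        moreover have "\<alpha> + \<beta> = \<alpha>' + \<beta> + unit_index k" by (simp add: \<alpha> add_ac)
        ultimately show ?thesis
          using True \<alpha> by (simp add: dp_mult_power dp_deriv_power dp_distrib at_k cancel)
      next
        case False
        then obtain \<beta>' where \<beta>: "\<beta> = \<beta>' + unit_index k" using shift by blast
        have sum: "\<alpha> + \<beta> = \<alpha>' + \<beta>' + unit_index k + unit_index k"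
          "\<alpha>' + \<beta> = \<alpha>' + \<beta>' + unit_index k" "\<alpha> + \<beta>' = \<alpha>' + \<beta>' + unit_index k"
          by (simp_all add: \<alpha> \<beta> add_ac)
        have "dp_deriv k (dp_mult (dp_power \<alpha>) (dp_power \<beta>)) =
            dp_scale (of_nat (multi_choose (\<alpha> + \<beta>) \<alpha>)) (dp_power (\<alpha>' + \<beta>) :: ('m, 'a) dp)"
          unfolding dp_mult_power dp_distrib dp_deriv_power sum cancel by (simp add: at_k)
        also have "\<dots> = dp_mult (dp_power \<alpha>') (dp_power \<beta>) + dp_mult (dp_power \<alpha>) (dp_power \<beta>')"
          using multi_choose_pascal[of \<alpha>' \<beta>' k, folded \<alpha>, folded sum]
          by (simp add: dp_mult_power sum(2,3) dp.scale_left_distrib)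
        finally show ?thesis
          using \<alpha> \<beta> by (simp add: dp_deriv_power at_k cancel)
      qed
    qed
  qed (rule dp_linearI; simp add: dp_distrib dp.scale_right_distrib add_ac)+
qed (rule dp_linearI; simp add: dp_distrib dp.scale_right_distrib add_ac)+

section \<open>Vector fields\<close>

definition vector_field :: "('m::finite \<Rightarrow> ('m, 'a::field) dp) \<Rightarrow> ('m, 'a) dp_op" where
  "vector_field f h = (\<Sum>k\<in>UNIV. dp_mult (f k) (dp_deriv k h))"

lemma linear_vector_field: "Vector_Spaces.linear dp_scale dp_scale (vector_field f)"
  for f :: "'m::finite \<Rightarrow> ('m, 'a::field) dp"
  by (rule dp_linearI)
    (simp_all add: vector_field_def dp_distrib sum.distrib dp.scale_sum_right)

interpretation vector_field: Vector_Spaces.linear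
  "dp_scale :: 'a::field \<Rightarrow> ('m::finite, 'a) dp \<Rightarrow> _" dp_scale "vector_field f" for f
  by (rule linear_vector_field)

lemma vector_field_mult:
  "vector_field f (dp_mult g h) = dp_mult (vector_field f g) h + dp_mult g (vector_field f h)"
  for f :: "'m::finite \<Rightarrow> ('m, 'a::field) dp"
proof -
  have "dp_mult (f k) (dp_deriv k (dp_mult g h)) =
      dp_mult (dp_mult (f k) (dp_deriv k g)) h + dp_mult g (dp_mult (f k) (dp_deriv k h))" for k
    by (simp add: dp_deriv_mult dp_distrib dp_mult_assoc dp_mult_left_commute[of g])
  thus ?thesis
    by (simp add: vector_field_def dp_distrib sum.distrib)
qed

lemma dp_deriv_vector_field:
  "dp_deriv l (vector_field f h) =
     vector_field (\<lambda>k. dp_deriv l (f k)) h + vector_field f (dp_deriv l h)"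
  for f :: "'m::finite \<Rightarrow> ('m, 'a::field) dp"
  by (simp add: vector_field_def dp_distrib dp_deriv_mult sum.distrib dp_deriv_commute[of l])

text \<open>
  The second-order terms \<open>d\<^sub>k e\<^sub>l \<partial>\<^sub>k\<partial>\<^sub>l h\<close> of the two compositions agree because partial derivatives
  commute; what survives is of first order.
\<close>

lemma vector_field_bracket:
  fixes d e :: "'m::finite \<Rightarrow> ('m, 'a::field) dp"
  shows "vector_field d (vector_field e h) - vector_field e (vector_field d h) =
     vector_field (\<lambda>i. vector_field d (e i) - vector_field e (d i)) h"
proof -
  have expand: "vector_field d (vector_field e h) =
      vector_field (\<lambda>i. vector_field d (e i)) h +
      (\<Sum>k\<in>UNIV. \<Sum>l\<in>UNIV. dp_mult (d k) (dp_mult (e l) (dp_deriv k (dp_deriv l h))))" for d e :: "'m \<Rightarrow> ('m, 'a) dp"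
  proof -
    have "vector_field d (vector_field e h) =
        (\<Sum>l\<in>UNIV. vector_field d (dp_mult (e l) (dp_deriv l h)))"
      by (simp add: vector_field_def[of e] vector_field.sum)
    also have "\<dots> = vector_field (\<lambda>i. vector_field d (e i)) h +
        (\<Sum>l\<in>UNIV. dp_mult (e l) (vector_field d (dp_deriv l h)))"
      by (simp add: vector_field_mult sum.distrib vector_field_def[of "\<lambda>i. vector_field d (e i)"])
    also have "(\<Sum>l\<in>UNIV. dp_mult (e l) (vector_field d (dp_deriv l h))) =
      (\<Sum>l\<in>UNIV. \<Sum>k\<in>UNIV. dp_mult (d k) (dp_mult (e l) (dp_deriv k (dp_deriv l h))))"
      by (simp add: vector_field_def[of d] dp_distrib dp_mult_left_commute[of "e _"])
    also have "\<dots> = (\<Sum>k\<in>UNIV. \<Sum>l\<in>UNIV. dp_mult (d k) (dp_mult (e l) (dp_deriv k (dp_deriv l h))))"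
      by (rule sum.swap)
    finally show ?thesis .
  qed
  have "(\<Sum>k\<in>UNIV. \<Sum>l\<in>UNIV. dp_mult (e k) (dp_mult (d l) (dp_deriv k (dp_deriv l h)))) =
      (\<Sum>k\<in>UNIV. \<Sum>l\<in>UNIV. dp_mult (d k) (dp_mult (e l) (dp_deriv k (dp_deriv l h))))"
    by (subst sum.swap) (simp add: dp_mult_left_commute[of "e _"] dp_deriv_commute[of _ _ h])
  thus ?thesis
    unfolding expand[of d e] expand[of e d]
    by (simp add: vector_field_def[of "\<lambda>i. vector_field d (e i) - vector_field e (d i)"]
        vector_field_def[of "\<lambda>i. vector_field d (e i)"] vector_field_def[of "\<lambda>i. vector_field e (d i)"]
        dp_distrib sum_subtractf)
qed

text \<open>
  Each of the two halves equals \<open>\<Sum>\<^sub>j\<^sub>k \<partial>\<^sub>j(d\<^sub>k) \<partial>\<^sub>k(e\<^sub>j)\<close> plus a derivative of a divergence, and this sum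
  is symmetric in \<open>d\<close> and \<open>e\<close>.
\<close>

lemma div_bracket:
  fixes d e :: "'m::finite \<Rightarrow> ('m, 'a::field) dp"
  assumes "(\<Sum>j\<in>UNIV. dp_deriv j (d j)) = 0" "(\<Sum>j\<in>UNIV. dp_deriv j (e j)) = 0"
  shows "(\<Sum>j\<in>UNIV. dp_deriv j (vector_field d (e j) - vector_field e (d j))) = 0"
proof -
  have expand: "(\<Sum>j\<in>UNIV. dp_deriv j (vector_field d (e j))) =
      (\<Sum>j\<in>UNIV. \<Sum>k\<in>UNIV. dp_mult (dp_deriv j (d k)) (dp_deriv k (e j)))"
    if "(\<Sum>j\<in>UNIV. dp_deriv j (e j)) = 0" for d e :: "'m \<Rightarrow> ('m, 'a) dp"
  proof -
    have "(\<Sum>j\<in>UNIV. dp_deriv j (vector_field d (e j))) =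
        (\<Sum>j\<in>UNIV. vector_field (\<lambda>k. dp_deriv j (d k)) (e j)) +
        vector_field d (\<Sum>j\<in>UNIV. dp_deriv j (e j))"
      by (simp add: dp_deriv_vector_field sum.distrib vector_field.sum)
    thus ?thesis
      unfolding that by (simp add: vector_field.zero vector_field_def)
  qed
  have "(\<Sum>j\<in>UNIV. \<Sum>k\<in>UNIV. dp_mult (dp_deriv j (d k)) (dp_deriv k (e j))) =
      (\<Sum>j\<in>UNIV. \<Sum>k\<in>UNIV. dp_mult (dp_deriv j (e k)) (dp_deriv k (d j)))"
    by (subst sum.swap) (simp add: dp_mult_commute)
  thus ?thesis
    by (simp add: dp_deriv.diff sum_subtractf expand assms)
qed


section \<open>Binomial coefficients modulo a prime\<close>

lemma prime_dvd_prime_power_choose: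
  fixes p :: nat
  assumes "prime p" "0 < j" "j < p ^ k"
  shows "p dvd (p ^ k choose j)"
proof (rule ccontr)
  assume ndvd: "\<not> p dvd (p ^ k choose j)"
  have "j * (p ^ k choose j) = p ^ k * (p ^ k - 1 choose (j - 1))"
    using assms by (simp add: times_binomial_minus1_eq)
  hence "p ^ k dvd j * (p ^ k choose j)" by simp
  moreover have "coprime (p ^ k) (p ^ k choose j)"
    using ndvd assms(1) by (simp add: prime_imp_coprime)
  ultimately have "p ^ k dvd j"
    by (simp add: coprime_dvd_mult_left_iff)
  thus False
    using assms by (auto dest: dvd_imp_le)
qed

text \<open>
  The case of Kummer's theorem in which a carry leaves the first \<open>k\<close> digits. Writing the upper entry as
  \<open>p\<^sup>k + r\<close>, Vandermonde's identity leaves only terms with a factor \<open>p\<^sup>k choose j\<close>, \<open>0 < j < p\<^sup>k\<close>, and the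
  term for \<open>j = 0\<close>, which vanishes as \<open>r < a\<close>.
\<close>

lemma prime_dvd_choose_carry:
  fixes p :: nat
  assumes p: "prime p" and ab: "a < p ^ k" "b < p ^ k" "p ^ k \<le> a + b"
  shows "p dvd (a + b choose a)"
proof -
  define r where "r = a + b - p ^ k"
  have r: "a + b = p ^ k + r" "r < a"
    using ab by (auto simp: r_def)
  have "p dvd (p ^ k choose j) * (r choose (a - j))" if "j \<le> a" for j
  proof (cases "j = 0")
    case True
    thus ?thesis using r by (simp add: binomial_eq_0)
  next
    case False
    thus ?thesis
      using prime_dvd_prime_power_choose[OF p, of j k] that ab by simp
  qed
  thus ?thesis
    unfolding r(1) vandermonde[symmetric] by (intro dvd_sum) auto
qed

text \<open>
  By Pascal's rule consecutive entries of row \<open>p\<^sup>k - 1\<close> are opposite modulo \<open>p\<close>, and the first is \<open>1\<close>.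
\<close>

lemma prime_not_dvd_choose_top:
  fixes p :: nat
  assumes p: "prime p" and "a < p ^ k"
  shows "\<not> p dvd (p ^ k - 1 choose a)"
  using assms(2)
proof (induction a)
  case 0
  thus ?case using p by (auto simp: prime_nat_iff)
next
  case (Suc a)
  have "Suc (p ^ k - 1) = p ^ k"
    using p by (simp add: prime_gt_0_nat)
  hence "(p ^ k choose Suc a) = (p ^ k - 1 choose a) + (p ^ k - 1 choose Suc a)"
    by (metis binomial_Suc_Suc)
  moreover have "p dvd (p ^ k choose Suc a)"
    using prime_dvd_prime_power_choose[OF p] Suc.prems by simp
  ultimately show ?case
    using Suc by (metis Suc_lessD dvd_add_left_iff)
qed


section \<open>Truncated divided power algebras\<close>

text \<open>
  The locale takes the top index \<open>\<tau>\<close> as a parameter, fixed by its last assumption, since the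
  characteristic that determines it is visible only through the type of the coefficients; the
  parameter \<open>field_type\<close> names that type.
\<close>

locale truncated_dp =
  fixes n :: "'m::finite \<Rightarrow> nat" and \<tau> :: "'m \<Rightarrow> nat" and field_type :: "'a::field itself"
  assumes char_gt_2: "CHAR('a) > 2"
    and n_pos: "\<And>i. n i > 0"
    and Suc_top_index: "\<And>i. Suc (\<tau> i) = CHAR('a) ^ n i"
begin

abbreviation A :: "('m, 'a) dp set" where
  "A \<equiv> dp_trunc n"

text \<open>
  A Berezin-type integral: it annihilates all partial derivatives, so that integration by parts is
  available, and it makes \<open>A\<close> a Frobenius algebra.
\<close>

definition integral :: "('m, 'a) dp \<Rightarrow> 'a" where
  "integral f = Poly_Mapping.lookup f \<tau>"

lemma prime_char: "prime CHAR('a)"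
  using char_gt_2 by (intro prime_CHAR_semidom) simp

lemma top_index_eq: "\<tau> i = CHAR('a) ^ n i - 1"
  by (simp flip: Suc_top_index)

lemma top_index_ge: "\<tau> i \<ge> 2"
proof -
  have "CHAR('a) ^ 1 \<le> CHAR('a) ^ n i"
    using char_gt_2 n_pos[of i] by (intro power_increasing) auto
  thus ?thesis using char_gt_2 by (simp add: top_index_eq)
qed

lemma of_nat_top_index: "of_nat (\<tau> i) = (-1 :: 'a)"
proof -
  have "of_nat (Suc (\<tau> i)) = (0 :: 'a)"
    unfolding Suc_top_index using n_pos[of i] by simp
  thus ?thesis by (simp add: eq_neg_iff_add_eq_0 add.commute)
qed

lemma mem_A_iff: "f \<in> A \<longleftrightarrow> (\<forall>\<alpha>\<in>Poly_Mapping.keys f. \<alpha> \<le> \<tau>)"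
proof
  assume "f \<in> A"
  hence "f \<in> dp.span (dp_power ` {\<alpha>. \<alpha> \<le> \<tau>})"
    by (simp add: dp_trunc_def top_index_eq le_fun_def image_Collect)
  thus "\<forall>\<alpha>\<in>Poly_Mapping.keys f. \<alpha> \<le> \<tau>"
  proof (induction rule: dp.span_induct_alt)
    case (step c x y)
    show ?case
    proof
      fix \<beta> assume "\<beta> \<in> Poly_Mapping.keys (dp_scale c x + y)"
      hence "Poly_Mapping.lookup x \<beta> \<noteq> 0 \<or> Poly_Mapping.lookup y \<beta> \<noteq> 0"
        by (auto simp: in_keys_iff lookup_add)
      thus "\<beta> \<le> \<tau>"
        using step by (auto simp: lookup_dp_power in_keys_iff split: if_splits)
    qed
  qed simp
next
  assume "\<forall>\<alpha>\<in>Poly_Mapping.keys f. \<alpha> \<le> \<tau>"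
  hence "dp_power ` Poly_Mapping.keys f \<subseteq> {dp_power \<alpha> | \<alpha>. \<forall>i. \<alpha> i \<le> CHAR('a) ^ n i - 1}"
    by (auto simp: le_fun_def top_index_eq)
  thus "f \<in> A"
    unfolding dp_trunc_def using in_span_dp_powers[of f] dp.span_mono by blast
qed

lemma lookup_A: "f \<in> A \<Longrightarrow> \<not> \<alpha> \<le> \<tau> \<Longrightarrow> Poly_Mapping.lookup f \<alpha> = 0"
  by (auto simp: mem_A_iff in_keys_iff)

lemma subspace_A: "dp.subspace A"
  by (simp add: dp_trunc_def)

lemmas A_closed =
  dp.subspace_0[OF subspace_A] dp.subspace_add[OF subspace_A] dp.subspace_diff[OF subspace_A]
  dp.subspace_scale[OF subspace_A] dp.subspace_neg[OF subspace_A] dp.subspace_sum[OF subspace_A]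

lemma dp_power_in_A: "\<alpha> \<le> \<tau> \<Longrightarrow> dp_power \<alpha> \<in> A"
  by (simp add: mem_A_iff)

lemma one_in_A: "dp_power 0 \<in> A"
  by (rule dp_power_in_A) (simp add: le_fun_def)

lemma unit_index_le: "unit_index k \<le> \<tau>"
  using top_index_ge[of k] by (auto simp: le_fun_def unit_index_def)

lemma dp_deriv_in_A:
  assumes "f \<in> A" shows "dp_deriv k f \<in> A"
  unfolding mem_A_iff
proof
  fix \<alpha> assume "\<alpha> \<in> Poly_Mapping.keys (dp_deriv k f)"
  hence "\<alpha> + unit_index k \<in> Poly_Mapping.keys f"
    by (simp add: in_keys_iff lookup_dp_deriv)
  hence "\<alpha> + unit_index k \<le> \<tau>"
    using assms by (simp add: mem_A_iff)
  thus "\<alpha> \<le> \<tau>"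
    by (auto simp: le_fun_def intro: le_trans[OF le_add1])
qed

text \<open>
  This is why \<open>A\<close> is closed under multiplication: a product of basis elements of \<open>A\<close> that leaves the box
  below \<open>\<tau>\<close> overflows in some coordinate, where the binomial coefficient vanishes modulo \<open>p\<close>.
\<close>

lemma dp_mult_powers_outside:
  assumes "\<alpha> \<le> \<tau>" "\<beta> \<le> \<tau>" "\<not> \<alpha> + \<beta> \<le> \<tau>"
  shows "of_nat (multi_choose (\<alpha> + \<beta>) \<alpha>) = (0 :: 'a)"
proof -
  obtain i where i: "CHAR('a) ^ n i \<le> \<alpha> i + \<beta> i"
    using assms(3) by (auto simp: le_fun_def not_le less_eq_Suc_le Suc_top_index)
  have "\<alpha> i < CHAR('a) ^ n i" "\<beta> i < CHAR('a) ^ n i"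
    using assms(1,2) by (auto simp: le_fun_def less_Suc_eq_le simp flip: Suc_top_index)
  hence "CHAR('a) dvd (\<alpha> i + \<beta> i choose \<alpha> i)"
    using i by (rule prime_dvd_choose_carry[OF prime_char])
  also have "(\<alpha> i + \<beta> i choose \<alpha> i) dvd multi_choose (\<alpha> + \<beta>) \<alpha>"
    unfolding multi_choose_def
    using dvd_prodI[of UNIV i "\<lambda>i. (\<alpha> + \<beta>) i choose \<alpha> i"] by simp
  finally show ?thesis
    by (simp add: of_nat_eq_0_iff_char_dvd)
qed

lemma dp_mult_in_A:
  assumes "f \<in> A" "g \<in> A" shows "dp_mult f g \<in> A"
  unfolding dp_mult_def
proof (intro A_closed(6))
  fix \<alpha> \<beta> assume "\<alpha> \<in> Poly_Mapping.keys f" "\<beta> \<in> Poly_Mapping.keys g"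
  hence "\<alpha> \<le> \<tau>" "\<beta> \<le> \<tau>"
    using assms by (auto simp: mem_A_iff)
  thus "dp_scale (Poly_Mapping.lookup f \<alpha> * Poly_Mapping.lookup g \<beta> *
          of_nat (multi_choose (\<alpha> + \<beta>) \<alpha>)) (dp_power (\<alpha> + \<beta>)) \<in> A"
    using dp_mult_powers_outside[of \<alpha> \<beta>] A_closed(1,4) dp_power_in_A[of "\<alpha> + \<beta>"]
    by (cases "\<alpha> + \<beta> \<le> \<tau>") auto
qed

lemma vector_field_in_A:
  assumes "\<And>k. f k \<in> A" "h \<in> A" shows "vector_field f h \<in> A"
  unfolding vector_field_def by (intro A_closed(6) dp_mult_in_A dp_deriv_in_A assms)

lemma special_der_eq: "special_der n f h = (if h \<in> A then vector_field f h else 0)"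
  by (simp add: special_der_def vector_field_def)

lemma integral_distrib [simp]:
  "integral 0 = 0"
  "integral (f + g) = integral f + integral g"
  "integral (f - g) = integral f - integral g"
  "integral (- f) = - integral f"
  "integral (dp_scale c f) = c * integral f"
  "integral (sum F I) = (\<Sum>i\<in>I. integral (F i))"
  by (simp_all add: integral_def lookup_add lookup_minus lookup_sum)

lemma integral_deriv: "f \<in> A \<Longrightarrow> integral (dp_deriv k f) = 0"
  unfolding integral_def lookup_dp_deriv
  by (rule lookup_A) (auto simp: le_fun_def unit_index_def intro!: exI[of _ k])

lemma integral_vector_field:
  assumes f: "\<And>k. f k \<in> A" "(\<Sum>k\<in>UNIV. dp_deriv k (f k)) = 0" and h: "h \<in> A"
  shows "integral (vector_field f h) = 0"
proof -
  have "vector_field f h = (\<Sum>k\<in>UNIV. dp_deriv k (dp_mult (f k) h)) - dp_mult (\<Sum>k\<in>UNIV. dp_deriv k (f k)) h"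
    by (simp add: vector_field_def dp_deriv_mult dp_distrib sum.distrib)
  thus ?thesis
    using f h by (simp add: integral_deriv dp_mult_in_A dp_mult_left.zero)
qed

lemma integral_by_parts:
  assumes f: "\<And>k. f k \<in> A" "(\<Sum>k\<in>UNIV. dp_deriv k (f k)) = 0" and "g \<in> A" "h \<in> A"
  shows "integral (dp_mult g (vector_field f h)) = - integral (dp_mult (vector_field f g) h)"
  using integral_vector_field[OF f dp_mult_in_A[of g h]] assms(3,4)
  by (simp add: vector_field_mult eq_neg_iff_add_eq_0 add.commute)

text \<open>
  If \<open>f\<close> has a coefficient at \<open>\<alpha>\<close>, multiplying by \<open>x\<^bsup>(\<tau>-\<alpha>)\<^esup>\<close> moves it to the top, and the binomial
  coefficient that appears is a unit.
\<close>

lemma integral_pairing_nondegenerate: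
  assumes "f \<in> A" "f \<noteq> 0"
  shows "\<exists>g\<in>A. integral (dp_mult g f) \<noteq> 0"
proof -
  obtain \<alpha> where \<alpha>: "Poly_Mapping.lookup f \<alpha> \<noteq> 0"
    using assms(2) by (metis poly_mapping_eqI lookup_zero)
  have le: "\<alpha> \<le> \<tau>"
    using lookup_A[OF assms(1)] \<alpha> by blast
  have "integral (dp_mult f (dp_power (\<tau> - \<alpha>))) =
      (\<Sum>\<beta> | \<beta> \<le> \<tau>. if \<beta> = \<alpha> then Poly_Mapping.lookup f \<alpha> * of_nat (multi_choose \<tau> \<alpha>) else 0)"
    unfolding integral_def lookup_dp_mult
  proof (rule sum.cong[OF refl])
    fix \<beta> assume "\<beta> \<in> {\<beta>. \<beta> \<le> \<tau>}"
    hence "\<tau> - \<alpha> = \<tau> - \<beta> \<longleftrightarrow> \<beta> = \<alpha>"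
      using le unfolding fun_eq_iff le_fun_def fun_diff_def by (simp; metis diff_diff_cancel)
    thus "Poly_Mapping.lookup f \<beta> * Poly_Mapping.lookup (dp_power (\<tau> - \<alpha>)) (\<tau> - \<beta>) *
        of_nat (multi_choose \<tau> \<beta>) =
      (if \<beta> = \<alpha> then Poly_Mapping.lookup f \<alpha> * of_nat (multi_choose \<tau> \<alpha>) else 0)"
      by (simp add: lookup_dp_power)
  qed
  also have "\<dots> = Poly_Mapping.lookup f \<alpha> * of_nat (multi_choose \<tau> \<alpha>)"
    using le by (simp add: finite_multi_indices_le)
  also have "\<dots> \<noteq> 0"
  proof -
    have "\<not> CHAR('a) dvd (\<tau> i choose \<alpha> i)" for i
      using prime_not_dvd_choose_top[OF prime_char, of "\<alpha> i" "n i"] le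
      by (simp add: le_fun_def less_Suc_eq_le top_index_eq[symmetric] flip: Suc_top_index)
    thus ?thesis
      using \<alpha> by (simp add: multi_choose_def of_nat_eq_0_iff_char_dvd)
  qed
  finally show ?thesis
    using dp_power_in_A[of "\<tau> - \<alpha>"] by (auto simp: dp_mult_commute le_fun_def)
qed

lemma finite_A_basis: "finite (dp_power ` {\<alpha>. \<alpha> \<le> \<tau>} :: ('m, 'a) dp set)"
  by (simp add: finite_multi_indices_le)

lemma A_subset_span: "A \<subseteq> dp.span (dp_power ` {\<alpha>. \<alpha> \<le> \<tau>})"
  by (simp add: dp_trunc_def top_index_eq le_fun_def image_Collect)

end

section \<open>Tuples\<close>

definition tuple_scale :: "'a::field \<Rightarrow> ('m \<Rightarrow> ('m, 'a) dp) \<Rightarrow> 'm \<Rightarrow> ('m, 'a) dp" where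
  "tuple_scale c a = (\<lambda>i. dp_scale c (a i))"

interpretation tuple: vector_space
  "tuple_scale :: 'a::field \<Rightarrow> ('m \<Rightarrow> ('m, 'a) dp) \<Rightarrow> 'm \<Rightarrow> ('m, 'a) dp"
  by unfold_locales
    (auto simp: tuple_scale_def fun_eq_iff dp.scale_right_distrib dp.scale_left_distrib)

lemma tuple_linearI:
  fixes F :: "('m \<Rightarrow> ('m, 'a::field) dp) \<Rightarrow> ('m \<Rightarrow> ('m, 'a) dp)"
  assumes "\<And>a b. F (\<lambda>i. a i + b i) = (\<lambda>i. F a i + F b i)"
    "\<And>c a. F (\<lambda>i. dp_scale c (a i)) = (\<lambda>i. dp_scale c (F a i))"
  shows "Vector_Spaces.linear tuple_scale tuple_scale F"
  by unfold_locales (simp_all add: tuple_scale_def plus_fun_def assms)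

context truncated_dp
begin

abbreviation A_tuples :: "('m \<Rightarrow> ('m, 'a) dp) set" where
  "A_tuples \<equiv> {a. \<forall>i. a i \<in> A}"

lemma subspace_A_tuples: "tuple.subspace A_tuples"
  unfolding tuple.subspace_def by (auto simp: tuple_scale_def A_closed)

lemma A_tuples_finite_dimensional:
  obtains B where "finite B" "A_tuples \<subseteq> tuple.span B"
proof
  define single :: "'m \<Rightarrow> ('m, 'a) dp \<Rightarrow> 'm \<Rightarrow> ('m, 'a) dp" where
    "single = (\<lambda>k f i. if i = k then f else 0)"
  let ?B = "(\<lambda>(k, \<alpha>). single k (dp_power \<alpha>)) ` (UNIV \<times> {\<alpha>. \<alpha> \<le> \<tau>})"
  show "finite ?B"
    by (simp add: finite_multi_indices_le)
  have single_span: "single k f \<in> tuple.span ?B" if "f \<in> A" for k f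
  proof -
    have "f \<in> dp.span (dp_power ` {\<alpha>. \<alpha> \<le> \<tau>})"
      using that A_subset_span by blast
    thus ?thesis
    proof (induction rule: dp.span_induct_alt)
      case base
      have "single k 0 = 0" by (auto simp: single_def)
      thus ?case by (simp only: tuple.span_zero)
    next
      case (step c x y)
      have "single k (dp_scale c x + y) = tuple_scale c (single k x) + single k y"
        by (auto simp: single_def tuple_scale_def fun_eq_iff)
      moreover have "single k x \<in> tuple.span ?B"
        using step(1) by (intro tuple.span_base) auto
      ultimately show ?case
        using step(2) by (simp only: tuple.span_add tuple.span_scale)
    qed
  qed
  show "A_tuples \<subseteq> tuple.span ?B"
  proof
    fix a assume a: "a \<in> A_tuples"
    have "(\<lambda>i. if i \<in> K then a i else 0) \<in> tuple.span ?B" if "finite K" for K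
      using that
    proof induction
      case empty
      show ?case using tuple.span_zero by (simp add: zero_fun_def)
    next
      case (insert k K)
      have "(\<lambda>i. if i \<in> insert k K then a i else 0) = single k (a k) + (\<lambda>i. if i \<in> K then a i else 0)"
        using insert(2) by (auto simp: single_def fun_eq_iff)
      moreover have "single k (a k) \<in> tuple.span ?B"
        using a by (intro single_span) auto
      ultimately show ?case
        using insert.IH by (simp only: tuple.span_add)
    qed
    from this[of UNIV] show "a \<in> tuple.span ?B" by simp
  qed
qed

lemma tuple_inj_imp_surj:
  assumes "tuple.subspace V" "V \<subseteq> A_tuples"
    and "Vector_Spaces.linear tuple_scale tuple_scale F"
    and "\<And>v. v \<in> V \<Longrightarrow> F v \<in> V" "\<And>v. v \<in> V \<Longrightarrow> F v = 0 \<Longrightarrow> v = 0" "w \<in> V"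
  shows "\<exists>v\<in>V. F v = w"
proof -
  obtain B where "finite B" "A_tuples \<subseteq> tuple.span B"
    by (rule A_tuples_finite_dimensional)
  thus ?thesis
    using assms tuple.linear_inj_imp_surj_on_subspace[of B V F w] by blast
qed


section \<open>Invariants\<close>

abbreviation constants :: "('m, 'a) dp set" where
  "constants \<equiv> {dp_scale c (dp_power 0) | c. True}"

text \<open>
  The forms \<open>X_top i dx\<^sub>i\<close> are closed but not exact, because \<open>x\<^sub>i\<^bsup>(\<tau>\<^sub>i+1)\<^esup>\<close> is missing from \<open>A\<close>; this is
  the content of the next lemmas.
\<close>

definition X_top :: "'m \<Rightarrow> ('m, 'a) dp" where
  "X_top i = dp_power (\<lambda>k. if k = i then \<tau> k else 0)"

lemma X_top_in_A: "X_top i \<in> A"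
  unfolding X_top_def by (rule dp_power_in_A) (simp add: le_fun_def)

lemma dp_deriv_X_top:
  "dp_deriv k (X_top i) = (if k = i then dp_power (\<lambda>l. if l = i then \<tau> l - 1 else 0) else 0)"
proof -
  have "(\<lambda>l. if l = i then \<tau> l else 0) - unit_index i = (\<lambda>l. if l = i then \<tau> l - 1 else 0)"
    by (auto simp: fun_eq_iff unit_index_def)
  thus ?thesis
    using top_index_ge[of i] by (auto simp: X_top_def dp_deriv_power)
qed

lemma X_top_not_deriv:
  assumes "g \<in> A" "dp_scale c (X_top k) = dp_deriv k g"
  shows "c = 0"
proof -
  let ?\<alpha> = "\<lambda>l. if l = k then \<tau> l else 0"
  have "c = Poly_Mapping.lookup (dp_deriv k g) ?\<alpha>"
    unfolding assms(2)[symmetric] by (simp add: X_top_def lookup_dp_power)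
  also have "\<dots> = 0"
    unfolding lookup_dp_deriv
    by (rule lookup_A[OF assms(1)]) (auto simp: le_fun_def unit_index_def intro!: exI[of _ k])
  finally show ?thesis .
qed

text \<open>
  With a one-dimensional kernel, \<open>f\<close> has an image of codimension one, hence all of the kernel of the
  integral. To avoid counting dimensions, the field is perturbed into the injective map \<open>F\<close> below.
\<close>

lemma image_of_field_without_invariants:
  assumes f: "\<And>k. f k \<in> A" "(\<Sum>k\<in>UNIV. dp_deriv k (f k)) = 0"
    and ker: "\<And>h. h \<in> A \<Longrightarrow> vector_field f h = 0 \<Longrightarrow> h \<in> constants"
    and h: "h \<in> A" "integral h = 0"
  shows "\<exists>g\<in>A. vector_field f g = h"
proof -
  \<comment> \<open>The added term sends the constants, the kernel of the field, onto a complement of its image.\<close>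
  define F where "F g = vector_field f g + dp_scale (Poly_Mapping.lookup g 0) (dp_power \<tau>)" for g
  have int_F: "integral (F g) = Poly_Mapping.lookup g 0" if "g \<in> A" for g
    using integral_vector_field[OF f that] by (simp add: F_def) (simp add: integral_def lookup_dp_power)
  have "\<exists>g\<in>A. F g = h"
  proof (rule dp.linear_inj_imp_surj_on_subspace[OF finite_A_basis A_subset_span subspace_A])
    show "Vector_Spaces.linear dp_scale dp_scale F"
      by (rule dp_linearI)
        (simp_all add: F_def vector_field.add vector_field.scale lookup_add
          dp.scale_left_distrib dp.scale_right_distrib)
    show "F g \<in> A" if "g \<in> A" for g
      unfolding F_def by (intro A_closed vector_field_in_A f that dp_power_in_A order_refl)
    fix g assume g: "g \<in> A" "F g = 0"
    hence g0: "Poly_Mapping.lookup g 0 = 0"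
      using int_F[of g] by simp
    hence "vector_field f g = 0"
      using g(2) by (simp add: F_def)
    then obtain c where "g = dp_scale c (dp_power 0)"
      using ker[OF g(1)] by blast
    with g0 show "g = 0" by (simp add: lookup_dp_power)
  qed (fact h)
  then obtain g where g: "g \<in> A" "F g = h" by blast
  with int_F[of g] h have "Poly_Mapping.lookup g 0 = 0" by simp
  with g show ?thesis by (auto simp: F_def)
qed

text \<open>
  A field acting componentwise on a submodule without constant tuples is injective there, hence
  surjective, so all entries of all members are images under the field and have integral zero. But the
  integral cannot vanish on a nonzero \<open>A\<close>-submodule, by nondegeneracy of the pairing.
\<close>

lemma stable_submodule_contains_constant_tuple:
  assumes f: "\<And>k. f k \<in> A" "(\<Sum>k\<in>UNIV. dp_deriv k (f k)) = 0"
    and ker: "\<And>h. h \<in> A \<Longrightarrow> vector_field f h = 0 \<Longrightarrow> h \<in> constants"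
    and R: "tuple.subspace R" "R \<subseteq> A_tuples"
    and module: "\<And>g r. g \<in> A \<Longrightarrow> r \<in> R \<Longrightarrow> (\<lambda>i. dp_mult g (r i)) \<in> R"
    and stable: "\<And>r. r \<in> R \<Longrightarrow> (\<lambda>i. vector_field f (r i)) \<in> R"
    and r: "r \<in> R" "r \<noteq> 0"
  shows "\<exists>c\<in>R. c \<noteq> 0 \<and> (\<forall>i. c i \<in> constants)"
proof (rule ccontr)
  assume no_constants: "\<not> ?thesis"
  obtain i where "r i \<noteq> 0" using r(2) by (auto simp: fun_eq_iff)
  then obtain g where g: "g \<in> A" "integral (dp_mult g (r i)) \<noteq> 0"
    using integral_pairing_nondegenerate[of "r i"] r(1) R(2) by blast
  have "\<exists>v\<in>R. (\<lambda>i. vector_field f (v i)) = (\<lambda>i. dp_mult g (r i))"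
  proof (rule tuple_inj_imp_surj[OF R])
    show "Vector_Spaces.linear tuple_scale tuple_scale (\<lambda>v i. vector_field f (v i))"
      by (rule tuple_linearI) (simp_all add: vector_field.add vector_field.scale)
    fix v assume v: "v \<in> R"
    thus "(\<lambda>i. vector_field f (v i)) \<in> R" by (rule stable)
    assume "(\<lambda>i. vector_field f (v i)) = 0"
    hence "vector_field f (v i) = 0" for i by (simp add: fun_eq_iff)
    hence "\<forall>i. v i \<in> constants"
      using v R(2) ker by blast
    with v no_constants show "v = 0" by blast
  qed (rule module[OF g(1) r(1)])
  then obtain v where v: "v \<in> R" "vector_field f (v i) = dp_mult g (r i)"
    by (metis (mono_tags))
  have "v i \<in> A" using v(1) R(2) by blast
  from integral_vector_field[OF f this] g(2) v(2) show False by simp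
qed

text \<open>
  The hypothesis \<open>exact\<close> says that the \<open>(m-1)\<close>-form obtained by contracting the volume form with \<open>f\<close>
  has trivial de Rham class. It cannot be dropped: for \<open>m = 2\<close> the field
  \<open>\<partial>\<^sub>1 + x\<^sub>1\<^bsup>(\<tau>\<^sub>1)\<^esup>\<partial>\<^sub>2\<close> is divergence-free, yet only constants are invariant.
  Here \<open>\<theta> i k\<close> is the \<open>k\<close>-th component of the form \<open>\<theta>\<^sub>i = X\<^sub>i dx\<^sub>i - dg\<^sub>i\<close>, and \<open>T\<close> sends \<open>a\<close> to the
  components of \<open>\<Sum>\<^sub>i a\<^sub>i \<theta>\<^sub>i\<close>.
\<close>

lemma exists_nonconstant_invariant:
  assumes f: "\<And>k. f k \<in> A" "(\<Sum>k\<in>UNIV. dp_deriv k (f k)) = 0"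
    and exact: "\<And>i. integral (dp_mult (X_top i) (f i)) = 0"
  shows "\<exists>h\<in>A - constants. vector_field f h = 0"
proof (rule ccontr)
  assume "\<not> ?thesis"
  hence ker: "h \<in> constants" if "h \<in> A" "vector_field f h = 0" for h
    using that by blast
  have "\<exists>g\<in>A. vector_field f g = dp_mult (X_top i) (f i)" for i
    by (intro image_of_field_without_invariants[OF f ker] exact dp_mult_in_A X_top_in_A f)
  then obtain g where g: "\<And>i. g i \<in> A" "\<And>i. vector_field f (g i) = dp_mult (X_top i) (f i)"
    by metis
  define \<theta> where "\<theta> i k = (if k = i then X_top i else 0) - dp_deriv k (g i)" for i k
  have \<theta>_in_A: "\<theta> i k \<in> A" for i k
    by (auto simp: \<theta>_def intro!: A_closed X_top_in_A dp_deriv_in_A g)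
  have \<theta>_f: "(\<Sum>k\<in>UNIV. dp_mult (f k) (\<theta> i k)) = 0" for i
  proof -
    have "(\<Sum>k\<in>UNIV. dp_mult (f k) (\<theta> i k)) =
        (\<Sum>k\<in>UNIV. if k = i then dp_mult (f i) (X_top i) else 0) - vector_field f (g i)"
      unfolding vector_field_def sum_subtractf[symmetric]
      by (intro sum.cong refl) (auto simp: \<theta>_def dp_distrib)
    thus ?thesis by (simp add: g dp_mult_commute)
  qed
  have closed: "dp_deriv l (\<theta> i k) = dp_deriv k (\<theta> i l)" for i k l
    by (auto simp: \<theta>_def dp_distrib dp_deriv_X_top dp_deriv.zero dp_deriv_commute)
  \<comment> \<open>The Lie derivative of a closed form annihilated by the field is zero, by Cartan's formula;
    in components, differentiate the identity \<open>\<theta>_f\<close>.\<close>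
  have invariant: "vector_field f (\<theta> i k) = - (\<Sum>l\<in>UNIV. dp_mult (dp_deriv k (f l)) (\<theta> i l))" for i k
  proof -
    have "0 = dp_deriv k (\<Sum>l\<in>UNIV. dp_mult (f l) (\<theta> i l))"
      by (simp add: \<theta>_f dp_deriv.zero)
    also have "\<dots> = (\<Sum>l\<in>UNIV. dp_mult (dp_deriv k (f l)) (\<theta> i l)) +
        (\<Sum>l\<in>UNIV. dp_mult (f l) (dp_deriv k (\<theta> i l)))"
      by (simp add: dp_deriv.sum dp_deriv_mult sum.distrib)
    also have "(\<Sum>l\<in>UNIV. dp_mult (f l) (dp_deriv k (\<theta> i l))) = vector_field f (\<theta> i k)"
      by (simp add: vector_field_def closed[of _ _ k])
    finally show ?thesis by (simp add: eq_neg_iff_add_eq_0 add.commute)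
  qed
  define T where "T a = (\<lambda>k. \<Sum>i\<in>UNIV. dp_mult (a i) (\<theta> i k))" for a
  have T_linear: "Vector_Spaces.linear tuple_scale tuple_scale T"
    by (rule tuple_linearI) (simp_all add: T_def dp_distrib sum.distrib dp.scale_sum_right)
  interpret T: Vector_Spaces.linear tuple_scale tuple_scale T by (fact T_linear)
  have T_in: "T a \<in> A_tuples" if "a \<in> A_tuples" for a
    using that by (auto simp: T_def intro!: A_closed dp_mult_in_A \<theta>_in_A)
  define R where "R = {a \<in> A_tuples. T a = 0}"
  have R_eq: "(\<Sum>i\<in>UNIV. dp_mult (a i) (\<theta> i k)) = 0" if "a \<in> R" for a k
    using that by (simp add: R_def T_def fun_eq_iff)
  have R_trivial: "a = 0" if "a \<in> R" for a
  proof (rule ccontr)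
    assume "a \<noteq> 0"
    have "\<exists>c\<in>R. c \<noteq> 0 \<and> (\<forall>i. c i \<in> constants)"
    proof (rule stable_submodule_contains_constant_tuple[OF f ker])
      show "tuple.subspace R"
        using subspace_A_tuples unfolding R_def tuple.subspace_def
        by (auto simp: T.zero T.add T.scale)
      show "R \<subseteq> A_tuples" by (auto simp: R_def)
      fix b assume b: "b \<in> R"
      show "(\<lambda>i. dp_mult h (b i)) \<in> R" if "h \<in> A" for h
      proof -
        have "(\<Sum>i\<in>UNIV. dp_mult (dp_mult h (b i)) (\<theta> i k)) = 0" for k
          using R_eq[OF b, of k] by (simp add: dp_mult_assoc dp_mult_right.zero flip: dp_mult_right.sum)
        thus ?thesis
          using b that by (auto simp: R_def T_def dp_mult_in_A)
      qed
      show "(\<lambda>i. vector_field f (b i)) \<in> R"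
      proof -
        have "(\<Sum>i\<in>UNIV. dp_mult (vector_field f (b i)) (\<theta> i k)) = 0" for k
        proof -
          have "0 = vector_field f (\<Sum>i\<in>UNIV. dp_mult (b i) (\<theta> i k))"
            by (simp add: R_eq[OF b] vector_field.zero)
          also have "\<dots> = (\<Sum>i\<in>UNIV. dp_mult (vector_field f (b i)) (\<theta> i k)) -
              (\<Sum>i\<in>UNIV. \<Sum>l\<in>UNIV. dp_mult (dp_deriv k (f l)) (dp_mult (b i) (\<theta> i l)))"
            by (simp add: vector_field.sum vector_field_mult invariant dp_distrib
                sum_subtractf dp_mult_left_commute[of "b _"])
          also have "(\<Sum>i\<in>UNIV. \<Sum>l\<in>UNIV. dp_mult (dp_deriv k (f l)) (dp_mult (b i) (\<theta> i l))) =
              (\<Sum>l\<in>UNIV. dp_mult (dp_deriv k (f l)) (\<Sum>i\<in>UNIV. dp_mult (b i) (\<theta> i l)))"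
            by (subst sum.swap) (simp add: dp_mult_right.sum)
          finally show ?thesis by (simp add: R_eq[OF b])
        qed
        thus ?thesis
          using b by (auto simp: R_def T_def vector_field_in_A f)
      qed
    qed (use \<open>a \<in> R\<close> \<open>a \<noteq> 0\<close> in auto)
    then obtain c where c: "c \<in> R" "c \<noteq> 0" "\<forall>i. \<exists>z. c i = dp_scale z (dp_power 0)"
      by auto
    then obtain z where z: "\<And>i. c i = dp_scale (z i) (dp_power 0)" by metis
    \<comment> \<open>A relation with constant coefficients makes a combination of the \<open>X\<^sub>i dx\<^sub>i\<close> exact.\<close>
    have "z k = 0" for k
    proof (rule X_top_not_deriv)
      show "(\<Sum>i\<in>UNIV. dp_scale (z i) (g i)) \<in> A"
        by (intro A_closed g)
      have "0 = (\<Sum>i\<in>UNIV. dp_scale (z i) (\<theta> i k))"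
        using R_eq[OF c(1), of k] by (simp add: z dp_distrib)
      also have "\<dots> = (\<Sum>i\<in>UNIV. if i = k then dp_scale (z k) (X_top k) else 0) -
          dp_deriv k (\<Sum>i\<in>UNIV. dp_scale (z i) (g i))"
        unfolding dp_deriv.sum dp_deriv.scale sum_subtractf[symmetric]
        by (intro sum.cong refl) (auto simp: \<theta>_def dp.scale_right_diff_distrib)
      finally show "dp_scale (z k) (X_top k) = dp_deriv k (\<Sum>i\<in>UNIV. dp_scale (z i) (g i))"
        by simp
    qed
    hence "c = 0" by (auto simp: fun_eq_iff z)
    with c(2) show False ..
  qed
  have "f l = 0" for l
  proof -
    \<comment> \<open>As the forms \<open>\<theta>\<^sub>i\<close> are a basis, \<open>dx\<^sub>l\<close> is a combination of them, so it too annihilates the field.\<close>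
    define e where "e = (\<lambda>k. if k = l then dp_power 0 else (0 :: ('m, 'a) dp))"
    have "\<exists>a\<in>A_tuples. T a = e"
    proof (rule tuple_inj_imp_surj[OF subspace_A_tuples order_refl T_linear T_in])
      show "a = 0" if "a \<in> A_tuples" "T a = 0" for a
        using that by (intro R_trivial) (simp add: R_def)
      show "e \<in> A_tuples"
        using one_in_A A_closed(1) by (simp add: e_def)
    qed
    then obtain a where a: "T a = e" by blast
    have "f l = (\<Sum>k\<in>UNIV. dp_mult (f k) (e k))"
      by (simp add: e_def if_distrib[of "dp_mult _"] dp_mult_right.zero cong: if_cong)
    also have "\<dots> = (\<Sum>k\<in>UNIV. \<Sum>i\<in>UNIV. dp_mult (a i) (dp_mult (f k) (\<theta> i k)))"
      by (simp add: a[symmetric] T_def dp_mult_right.sum dp_mult_left_commute[of "a _"])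
    also have "\<dots> = (\<Sum>i\<in>UNIV. dp_mult (a i) (\<Sum>k\<in>UNIV. dp_mult (f k) (\<theta> i k)))"
      by (subst sum.swap) (simp add: dp_mult_right.sum)
    finally show ?thesis by (simp add: \<theta>_f)
  qed
  hence "vector_field f (dp_power \<tau>) = 0"
    by (simp add: vector_field_def dp_mult_left.zero)
  hence "dp_power \<tau> \<in> constants"
    using dp_power_in_A[of \<tau>] ker by blast
  then obtain c :: 'a where "dp_power \<tau> = dp_scale c (dp_power 0)" by blast
  hence "Poly_Mapping.lookup (dp_power \<tau> :: ('m, 'a) dp) \<tau> = Poly_Mapping.lookup (dp_scale c (dp_power 0)) \<tau>"
    by simp
  hence "\<tau> = 0"
    by (auto simp: lookup_dp_power split: if_splits)
  thus False
    using top_index_ge[of undefined] by simp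
qed

section \<open>The derived algebra of divergence-free fields\<close>

lemma S_alg_iff:
  "D \<in> S_alg n \<longleftrightarrow>
     (\<exists>f. (\<forall>k. f k \<in> A) \<and> (\<Sum>k\<in>UNIV. dp_deriv k (f k)) = 0 \<and> D = special_der n f)"
proof -
  have "divergence n (special_der n f) = (\<Sum>k\<in>UNIV. dp_deriv k (f k))" if "\<forall>k. f k \<in> A" for f
    using that char_gt_2 by (intro divergence_special_der n_pos) auto
  thus ?thesis
    unfolding S_alg_def W_alg_def by auto
qed

lemma op_bracket_special_der:
  assumes "\<And>k. d k \<in> A" "\<And>k. e k \<in> A"
  shows "op_bracket (special_der n d) (special_der n e) =
     special_der n (\<lambda>i. vector_field d (e i) - vector_field e (d i))"
proof
  fix h show "op_bracket (special_der n d) (special_der n e) h =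
     special_der n (\<lambda>i. vector_field d (e i) - vector_field e (d i)) h"
    using assms A_closed(1)
    by (simp add: op_bracket_def special_der_eq vector_field_in_A vector_field_bracket vector_field.zero)
qed

lemma bracket_in_S_alg_derived:
  assumes "\<And>k. d k \<in> A" "(\<Sum>k\<in>UNIV. dp_deriv k (d k)) = 0"
    and "\<And>k. e k \<in> A" "(\<Sum>k\<in>UNIV. dp_deriv k (e k)) = 0"
  shows "special_der n (\<lambda>i. vector_field d (e i) - vector_field e (d i)) \<in> S_alg_derived n"
  unfolding S_alg_derived_def lie_derived_def op_bracket_special_der[OF assms(1,3), symmetric]
  by (rule dp_op.span_base) (use assms in \<open>auto simp: S_alg_iff\<close>)

text \<open>
  For a bracket of \<open>d\<close> and \<open>e\<close>, integration by parts turns \<open>\<integral> X\<^sub>i d(e\<^sub>i)\<close> into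
  \<open>- \<integral> d\<^sub>i e\<^sub>i \<partial>\<^sub>i(X\<^sub>i)\<close>, which is symmetric in \<open>d\<close> and \<open>e\<close>, so the two halves cancel.
\<close>

lemma S_alg_derived_exact:
  assumes "D \<in> S_alg_derived n"
  obtains f where "\<And>k. f k \<in> A" "(\<Sum>k\<in>UNIV. dp_deriv k (f k)) = 0"
    "\<And>i. integral (dp_mult (X_top i) (f i)) = 0" "D = special_der n f"
proof -
  let ?P = "\<lambda>D f. (\<forall>k. f k \<in> A) \<and> (\<Sum>k\<in>UNIV. dp_deriv k (f k)) = 0 \<and>
    (\<forall>i. integral (dp_mult (X_top i) (f i)) = 0) \<and> D = special_der n f"
  have "\<exists>f. ?P D f"
    using assms unfolding S_alg_derived_def lie_derived_def
  proof (induction rule: dp_op.span_induct_alt)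
    case base
    have "?P 0 (\<lambda>_. 0)"
      by (auto simp: A_closed dp_deriv.zero special_der_eq vector_field_def fun_eq_iff dp_mult_left.zero)
    thus ?case by (rule exI[of _ "\<lambda>_. 0"])
  next
    case (step c x y)
    obtain D E where x: "x = op_bracket D E" "D \<in> S_alg n" "E \<in> S_alg n"
      using step(1) by blast
    obtain d where d: "\<And>k. d k \<in> A" "(\<Sum>k\<in>UNIV. dp_deriv k (d k)) = 0" "D = special_der n d"
      using x(2) by (auto simp: S_alg_iff)
    obtain e where e: "\<And>k. e k \<in> A" "(\<Sum>k\<in>UNIV. dp_deriv k (e k)) = 0" "E = special_der n e"
      using x(3) by (auto simp: S_alg_iff)
    obtain f where f: "?P y f" using step(2) by blast
    define b where "b = (\<lambda>i. vector_field d (e i) - vector_field e (d i))"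
    have b_A: "b k \<in> A" for k
      by (simp add: b_def A_closed vector_field_in_A d e)
    have b_div: "(\<Sum>k\<in>UNIV. dp_deriv k (b k)) = 0"
      unfolding b_def by (rule div_bracket) (fact d e)+
    have X_field: "vector_field d (X_top i) = dp_mult (d i) (dp_deriv i (X_top i))" for d i
      by (simp add: vector_field_def dp_deriv_X_top if_distrib[of "dp_mult _"] dp_mult_right.zero cong: if_cong)
    have b_exact: "integral (dp_mult (X_top i) (b i)) = 0" for i
      using integral_by_parts[OF d(1,2) X_top_in_A e(1), of i i]
        integral_by_parts[OF e(1,2) X_top_in_A d(1), of i i]
      by (simp add: b_def dp_mult_right.diff X_field dp_mult_ac)
    have "?P (op_scale c x + y) (\<lambda>k. dp_scale c (b k) + f k)"
    proof (intro conjI allI)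
      show "dp_scale c (b k) + f k \<in> A" for k
        using f by (simp add: A_closed b_A)
      show "(\<Sum>k\<in>UNIV. dp_deriv k (dp_scale c (b k) + f k)) = 0"
        using f b_div by (simp add: dp_distrib sum.distrib flip: dp.scale_sum_right)
      show "integral (dp_mult (X_top i) (dp_scale c (b i) + f i)) = 0" for i
        using f b_exact by (simp add: dp_distrib)
      show "op_scale c x + y = special_der n (\<lambda>k. dp_scale c (b k) + f k)"
        using f unfolding x(1) d(3) e(3) op_bracket_special_der[OF d(1) e(1)] b_def[symmetric]
        by (auto simp: fun_eq_iff op_scale_def special_der_eq vector_field_def dp_distrib sum.distrib
            dp.scale_sum_right)
    qed
    thus ?case by (rule exI[of _ "\<lambda>k. dp_scale c (b k) + f k"])
  qed
  thus thesis using that by blast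
qed

text \<open>
  \<open>\<partial>\<^sub>k = [\<partial>\<^sub>j, x\<^sub>j\<partial>\<^sub>k]\<close>; a second variable is required for \<open>x\<^sub>j\<partial>\<^sub>k\<close> to be divergence-free.
\<close>

lemma partial_in_S_alg_derived:
  assumes "j \<noteq> k"
  shows "special_der n (\<lambda>i. if i = k then dp_power 0 else (0 :: ('m, 'a) dp)) \<in> S_alg_derived n"
proof -
  define d e :: "'m \<Rightarrow> ('m, 'a) dp" where
    "d = (\<lambda>i. if i = j then dp_power 0 else 0)" and
    "e = (\<lambda>i. if i = k then dp_power (unit_index j) else 0)"
  have "special_der n (\<lambda>i. vector_field d (e i) - vector_field e (d i)) \<in> S_alg_derived n"
  proof (rule bracket_in_S_alg_derived)
    show "d i \<in> A" "e i \<in> A" for i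
      by (simp_all add: d_def e_def one_in_A A_closed dp_power_in_A unit_index_le)
    show "(\<Sum>k\<in>UNIV. dp_deriv k (d k)) = 0"
      by (rule sum.neutral) (simp add: d_def dp_deriv_power dp_deriv.zero)
    show "(\<Sum>k\<in>UNIV. dp_deriv k (e k)) = 0"
      using assms by (intro sum.neutral) (simp add: e_def dp_deriv_power dp_deriv.zero unit_index_def)
  qed
  also have "(\<lambda>i. vector_field d (e i) - vector_field e (d i)) = (\<lambda>i. if i = k then dp_power 0 else 0)"
  proof
    fix i
    have "vector_field e (d i) = 0"
      by (simp add: d_def vector_field_def dp_deriv_power dp_deriv.zero)
    moreover have "vector_field d (dp_power (unit_index j)) = (\<Sum>l\<in>UNIV. if l = j then dp_power 0 else 0)"
      unfolding vector_field_def by (intro sum.cong refl)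
        (auto simp: d_def dp_deriv_power dp_mult_left.zero unit_index_def)
    ultimately show "vector_field d (e i) - vector_field e (d i) = (if i = k then dp_power 0 else 0)"
      by (simp add: e_def vector_field.zero)
  qed
  finally show ?thesis .
qed

definition below_top :: "'m \<Rightarrow> ('m, 'a) dp" where
  "below_top k = dp_power (\<tau> - unit_index k)"

lemma dp_mult_disjoint:
  assumes "\<And>i. \<alpha> i = 0 \<or> \<beta> i = 0"
  shows "dp_mult (dp_power \<alpha>) (dp_power \<beta>) = (dp_power (\<alpha> + \<beta>) :: ('m, 'a) dp)"
proof -
  have "(\<alpha> i + \<beta> i choose \<alpha> i) = 1" for i using assms[of i] by auto
  thus ?thesis by (simp add: dp_mult_power multi_choose_def)
qed

text \<open>
  The field is the bracket of \<open>x\<^sub>i\<^bsup>(\<tau>\<^sub>i)\<^esup>\<partial>\<^sub>j\<close> and \<open>P\<partial>\<^sub>i\<close>, where \<open>P\<close> is the product of the \<open>x\<^sub>k\<^bsup>(\<tau>\<^sub>k)\<^esup>\<close> with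
  \<open>k \<noteq> i\<close>; neither coefficient involves the variable of its derivative.
\<close>

lemma top_field_in_S_alg_derived:
  assumes "i \<noteq> j"
  shows "special_der n (\<lambda>l. if l = i then below_top j else if l = j then - below_top i else 0) \<in> S_alg_derived n"
proof -
  define P :: "('m, 'a) dp" where "P = dp_power (\<lambda>l. if l = i then 0 else \<tau> l)"
  define d e :: "'m \<Rightarrow> ('m, 'a) dp" where
    "d = (\<lambda>l. if l = j then X_top i else 0)" and "e = (\<lambda>l. if l = i then P else 0)"
  have "special_der n (\<lambda>i. vector_field d (e i) - vector_field e (d i)) \<in> S_alg_derived n"
  proof (rule bracket_in_S_alg_derived)
    show "d l \<in> A" "e l \<in> A" for l
      by (simp_all add: d_def e_def P_def A_closed X_top_in_A dp_power_in_A le_fun_def)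
    show "(\<Sum>k\<in>UNIV. dp_deriv k (d k)) = 0"
      using assms by (intro sum.neutral) (simp add: d_def dp_deriv_X_top dp_deriv.zero)
    show "(\<Sum>k\<in>UNIV. dp_deriv k (e k)) = 0"
      by (intro sum.neutral) (simp add: e_def P_def dp_deriv_power dp_deriv.zero)
  qed
  also have "(\<lambda>i. vector_field d (e i) - vector_field e (d i)) =
      (\<lambda>l. if l = i then below_top j else if l = j then - below_top i else 0)"
  proof
    fix l
    have fields: "vector_field d h = dp_mult (X_top i) (dp_deriv j h)"
      "vector_field e h = dp_mult P (dp_deriv i h)" for h
      by (simp_all add: vector_field_def d_def e_def if_distrib[of "\<lambda>f. dp_mult f _"] dp_mult_left.zero cong: if_cong)
    have "dp_mult (X_top i) (dp_deriv j P) = below_top j"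
      using assms top_index_ge[of j]
      by (auto simp: X_top_def P_def dp_deriv_power dp_mult_disjoint below_top_def unit_index_def fun_eq_iff
          intro!: arg_cong[of _ _ dp_power])
    moreover have "dp_mult P (dp_deriv i (X_top i)) = below_top i"
      by (auto simp: P_def dp_deriv_X_top dp_mult_disjoint below_top_def unit_index_def fun_eq_iff
          intro!: arg_cong[of _ _ dp_power])
    ultimately show "vector_field d (e l) - vector_field e (d l) =
        (if l = i then below_top j else if l = j then - below_top i else 0)"
      unfolding fields using assms by (auto simp: d_def e_def dp_deriv.zero)
  qed
  finally show ?thesis .
qed

lemma multi_index_on_axis:
  fixes \<alpha> :: "'m \<Rightarrow> nat"
  assumes "\<And>i. i \<noteq> k \<Longrightarrow> \<alpha> i = 0"
  shows "\<alpha> k = 0 \<Longrightarrow> \<alpha> = 0" "\<alpha> k = 1 \<Longrightarrow> \<alpha> = unit_index k"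
    "\<alpha> k = 2 \<Longrightarrow> \<alpha> = unit_index k + unit_index k"
proof -
  have \<alpha>: "\<alpha> i = (if i = k then \<alpha> k else 0)" for i
    using assms by simp
  show "\<alpha> k = 0 \<Longrightarrow> \<alpha> = 0" "\<alpha> k = 1 \<Longrightarrow> \<alpha> = unit_index k"
    "\<alpha> k = 2 \<Longrightarrow> \<alpha> = unit_index k + unit_index k"
    by (rule ext, subst \<alpha>, simp add: unit_index_def)+
qed

text \<open>
  Only the constant term and the \<open>j\<close>-th linear term of \<open>g\<close> stay within the box below \<open>\<tau>\<close>. The sign is
  \<open>\<tau>\<^sub>j = p\<^bsup>n\<^sub>j\<^esup> - 1 = -1\<close> in the field.
\<close>

lemma below_top_mult:
  assumes "g \<in> A"
  shows "dp_mult (below_top j) g = dp_scale (Poly_Mapping.lookup g 0) (below_top j) -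
      dp_scale (Poly_Mapping.lookup g (unit_index j)) (dp_power \<tau>)"
proof (rule linear_eq_on_dp_powers[of "dp_mult (below_top j)" "\<lambda>g. dp_scale (Poly_Mapping.lookup g 0) (below_top j) -
      dp_scale (Poly_Mapping.lookup g (unit_index j)) (dp_power \<tau>)" g])
  fix \<beta> assume "\<beta> \<in> Poly_Mapping.keys g"
  hence \<beta>: "\<beta> \<le> \<tau>" using assms by (simp add: mem_A_iff)
  have unit_ne: "unit_index j \<noteq> 0" by (auto simp: unit_index_def fun_eq_iff)
  have top: "\<tau> - unit_index j + unit_index j = \<tau>"
    using unit_index_le[of j] by (auto simp: fun_eq_iff le_fun_def)
  consider "\<beta> = 0" | "\<beta> = unit_index j" | "\<beta> \<noteq> 0" "\<beta> \<noteq> unit_index j" by blast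
  thus "dp_mult (below_top j) (dp_power \<beta>) = dp_scale (Poly_Mapping.lookup (dp_power \<beta>) 0) (below_top j) -
      dp_scale (Poly_Mapping.lookup (dp_power \<beta>) (unit_index j)) (dp_power \<tau>)"
  proof cases
    case 1
    thus ?thesis using unit_ne by (simp add: lookup_dp_power)
  next
    case 2
    have "multi_choose \<tau> (\<tau> - unit_index j) = multi_choose \<tau> (unit_index j)"
      using multi_choose_commute[of "\<tau> - unit_index j" "unit_index j"] by (simp only: top)
    also have "\<dots> = (\<Prod>i\<in>UNIV. if i = j then \<tau> j else 1)"
      unfolding multi_choose_def by (intro prod.cong refl) (auto simp: unit_index_def)
    finally have "of_nat (multi_choose \<tau> (\<tau> - unit_index j)) = (-1 :: 'a)"
      by (simp add: of_nat_top_index)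
    thus ?thesis
      using 2 unit_ne by (simp add: below_top_def dp_mult_power top lookup_dp_power)
  next
    case 3
    have "\<not> (\<tau> - unit_index j) + \<beta> \<le> \<tau>"
    proof
      assume le: "(\<tau> - unit_index j) + \<beta> \<le> \<tau>"
      have "\<beta> i \<le> unit_index j i" for i
        using le_funD[OF le, of i] le_funD[OF unit_index_le[of j], of i] by simp
      hence "\<beta> i \<le> (if i = j then 1 else 0)" for i by (simp add: unit_index_def)
      from this[of j] and this have "\<beta> j = 0 \<or> \<beta> j = 1" "\<And>i. i \<noteq> j \<Longrightarrow> \<beta> i = 0"
        by (auto split: if_splits) (metis le_zero_eq)
      hence "\<beta> = 0 \<or> \<beta> = unit_index j" using multi_index_on_axis by blast
      with 3 show False by blast
    qed
    hence "of_nat (multi_choose (\<tau> - unit_index j + \<beta>) (\<tau> - unit_index j)) = (0 :: 'a)"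
      using \<beta> by (intro dp_mult_powers_outside) (auto simp: le_fun_def)
    thus ?thesis
      using 3 by (simp add: below_top_def dp_mult_power lookup_dp_power)
  qed
qed (rule linear_dp_mult_right dp_linearI;
    simp add: lookup_add dp.scale_left_distrib dp.scale_right_diff_distrib)+

text \<open>
  The two multiples of \<open>x\<^sup>\<tau>\<close> cancel, as both come from the coefficient of \<open>x\<^sub>i x\<^sub>j\<close> in \<open>h\<close>.
\<close>

lemma top_field_kills:
  assumes "i \<noteq> j" "h \<in> A"
    and "Poly_Mapping.lookup h (unit_index i) = 0" "Poly_Mapping.lookup h (unit_index j) = 0"
  shows "vector_field (\<lambda>l. if l = i then below_top j else if l = j then - below_top i else 0) h = 0"
proof -
  have "vector_field (\<lambda>l. if l = i then below_top j else if l = j then - below_top i else 0) h =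
      (\<Sum>l\<in>UNIV. (if l = i then dp_mult (below_top j) (dp_deriv i h) else 0) -
        (if l = j then dp_mult (below_top i) (dp_deriv j h) else 0))"
    unfolding vector_field_def using assms(1)
    by (intro sum.cong refl) (auto simp: dp_mult_left.zero dp_mult_left.neg)
  also have "\<dots> = dp_mult (below_top j) (dp_deriv i h) - dp_mult (below_top i) (dp_deriv j h)"
    by (simp add: sum_subtractf)
  also have "\<dots> = 0"
    using assms by (simp add: below_top_mult dp_deriv_in_A lookup_dp_deriv add.commute[of "unit_index i"])
  finally show ?thesis .
qed

text \<open>
  The square of an element without constant term has no linear terms, and its pure quadratic
  coefficients detect the linear terms of that element.
\<close>

lemma lookup_square:
  fixes g :: "('m, 'a) dp"
  assumes "Poly_Mapping.lookup g 0 = (0 :: 'a)"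
  shows "Poly_Mapping.lookup (dp_mult g g) 0 = 0"
    and "Poly_Mapping.lookup (dp_mult g g) (unit_index k) = 0"
    and "Poly_Mapping.lookup (dp_mult g g) (unit_index k + unit_index k) =
      2 * Poly_Mapping.lookup g (unit_index k) ^ 2"
proof -
  have le0: "\<alpha> \<le> 0 \<longleftrightarrow> \<alpha> = 0" for \<alpha> :: "'m \<Rightarrow> nat"
    by (auto simp: le_fun_def fun_eq_iff)
  show "Poly_Mapping.lookup (dp_mult g g) 0 = 0"
    by (simp add: lookup_dp_mult le0 assms)
  have le1: "\<alpha> = 0 \<or> \<alpha> = unit_index k" if "\<alpha> \<le> unit_index k" for \<alpha> :: "'m \<Rightarrow> nat"
  proof -
    have le: "\<alpha> i \<le> (if i = k then 1 else 0)" for i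
      using le_funD[OF that, of i] by (simp add: unit_index_def)
    have "\<alpha> i = 0" if "i \<noteq> k" for i using le[of i] that by simp
    moreover have "\<alpha> k = 0 \<or> \<alpha> k = 1" using le[of k] by auto
    ultimately show ?thesis using multi_index_on_axis by blast
  qed
  show "Poly_Mapping.lookup (dp_mult g g) (unit_index k) = 0"
    unfolding lookup_dp_mult
  proof (rule sum.neutral, rule ballI)
    fix \<alpha> assume "\<alpha> \<in> {\<alpha>. \<alpha> \<le> unit_index k}"
    hence "\<alpha> = 0 \<or> \<alpha> = unit_index k" using le1 by simp
    moreover have "unit_index k - unit_index k = (0 :: 'm \<Rightarrow> nat)" by (simp add: fun_eq_iff)
    ultimately show "Poly_Mapping.lookup g \<alpha> * Poly_Mapping.lookup g (unit_index k - \<alpha>) *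
        of_nat (multi_choose (unit_index k) \<alpha>) = 0"
      using assms by auto
  qed
  let ?\<beta> = "unit_index k + unit_index k :: 'm \<Rightarrow> nat"
  have le2: "\<alpha> = 0 \<or> \<alpha> = unit_index k \<or> \<alpha> = ?\<beta>" if "\<alpha> \<le> ?\<beta>" for \<alpha>
  proof -
    have le: "\<alpha> i \<le> (if i = k then 2 else 0)" for i
      using le_funD[OF that, of i] by (simp add: unit_index_def split: if_splits)
    have "\<alpha> i = 0" if "i \<noteq> k" for i using le[of i] that by simp
    moreover have "\<alpha> k = 0 \<or> \<alpha> k = 1 \<or> \<alpha> k = 2" using le[of k] by auto
    ultimately show ?thesis using multi_index_on_axis by blast
  qed
  have "multi_choose ?\<beta> (unit_index k) = (\<Prod>i\<in>UNIV. if i = k then 2 else 1)"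
    unfolding multi_choose_def by (intro prod.cong refl) (auto simp: unit_index_def)
  hence two: "multi_choose ?\<beta> (unit_index k) = 2" by simp
  have cancel: "?\<beta> - unit_index k = unit_index k" "?\<beta> - ?\<beta> = 0" by (auto simp: fun_eq_iff)
  have "Poly_Mapping.lookup (dp_mult g g) ?\<beta> =
      (\<Sum>\<alpha>\<in>{unit_index k}. Poly_Mapping.lookup g \<alpha> * Poly_Mapping.lookup g (?\<beta> - \<alpha>) *
        of_nat (multi_choose ?\<beta> \<alpha>))"
    unfolding lookup_dp_mult
  proof (rule sum.mono_neutral_right)
    show "\<forall>\<alpha>\<in>{\<alpha>. \<alpha> \<le> ?\<beta>} - {unit_index k}. Poly_Mapping.lookup g \<alpha> *
        Poly_Mapping.lookup g (?\<beta> - \<alpha>) * of_nat (multi_choose ?\<beta> \<alpha>) = 0"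
      using le2 assms cancel(2) by fastforce
    show "{unit_index k} \<subseteq> {\<alpha>. \<alpha> \<le> ?\<beta>}" by (simp add: le_fun_def)
  qed (rule finite_multi_indices_le)
  thus "Poly_Mapping.lookup (dp_mult g g) ?\<beta> = 2 * Poly_Mapping.lookup g (unit_index k) ^ 2"
    by (simp add: cancel(1) two power2_eq_square)
qed

lemma exists_invariant_without_linear_part:
  assumes h: "h \<in> A - constants" "vector_field f h = 0"
  shows "\<exists>u\<in>A - constants. vector_field f u = 0 \<and> (\<forall>k. Poly_Mapping.lookup u (unit_index k) = 0)"
proof -
  define g where "g = h - dp_scale (Poly_Mapping.lookup h 0) (dp_power 0)"
  have g0: "Poly_Mapping.lookup g 0 = 0"
    by (simp add: g_def lookup_minus lookup_dp_power)
  have "g \<in> A" using h(1) by (simp add: g_def A_closed one_in_A)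
  have "g \<noteq> 0" using h(1) by (auto simp: g_def)
  have "vector_field f (dp_power 0) = 0"
    by (simp add: vector_field_def dp_deriv_power)
  hence field_g: "vector_field f g = 0"
    by (simp add: g_def vector_field.diff vector_field.scale h(2))
  have not_constant: "u \<notin> constants" if "u \<noteq> 0" "Poly_Mapping.lookup u 0 = 0" for u
    using that by (auto simp: lookup_dp_power)
  show ?thesis
  proof (cases "dp_mult g g = 0")
    case True
    have "(2 :: 'a) \<noteq> 0"
      using of_nat_eq_0_iff_char_dvd[of 2, where 'a = 'a] char_gt_2 by (auto dest: dvd_imp_le)
    hence "Poly_Mapping.lookup g (unit_index k) = 0" for k
      using lookup_square(3)[OF g0, of k] by (simp add: True)
    thus ?thesis
      using \<open>g \<in> A\<close> \<open>g \<noteq> 0\<close> g0 field_g not_constant by blast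
  next
    case False
    have "vector_field f (dp_mult g g) = 0"
      by (simp add: vector_field_mult field_g dp_mult_left.zero)
    thus ?thesis
      using False not_constant lookup_square[OF g0] dp_mult_in_A[OF \<open>g \<in> A\<close> \<open>g \<in> A\<close>] by blast
  qed
qed

lemma constant_if_derivs_zero:
  assumes "\<And>k. dp_deriv k u = 0"
  shows "u \<in> constants"
proof -
  have "Poly_Mapping.lookup u \<alpha> = 0" if nonzero: "\<alpha> \<noteq> 0" for \<alpha> :: "'m \<Rightarrow> nat"
  proof -
    obtain k where "\<alpha> k \<noteq> 0" using nonzero by (metis ext zero_fun_apply)
    hence "\<alpha> = (\<alpha> - unit_index k) + unit_index k"
      by (auto simp: fun_eq_iff unit_index_def)
    thus ?thesis
      using lookup_dp_deriv[of k u "\<alpha> - unit_index k"] assms[of k] by simp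
  qed
  hence "u = dp_scale (Poly_Mapping.lookup u 0) (dp_power 0)"
    by (intro poly_mapping_eqI) (auto simp: lookup_dp_power)
  thus ?thesis by blast
qed

end

text \<open>
  The operators annihilating a fixed element form a Lie subalgebra. They are required to fix zero as
  well because the bracket composes arbitrary functions, not only linear ones.
\<close>

lemma lie_generated_annihilates:
  fixes X :: "('m, 'a::field) dp_op set"
  assumes "D \<in> lie_generated op_scale op_bracket X"
    and "\<And>E. E \<in> X \<Longrightarrow> E u = 0" "\<And>E. E \<in> X \<Longrightarrow> E 0 = 0"
  shows "D u = 0"
proof -
  have "lie_subalgebra op_scale op_bracket {D :: ('m, 'a) dp_op. D u = 0 \<and> D 0 = 0}"
    unfolding lie_subalgebra_def dp_op.subspace_def by (auto simp: op_scale_def op_bracket_def)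
  hence "lie_generated op_scale op_bracket X \<subseteq> {D. D u = 0 \<and> D 0 = 0}"
    unfolding lie_generated_def using assms(2,3) by (intro hull_minimal) auto
  with assms(1) show ?thesis by blast
qed

theorem theorem2p2p3:
  fixes n :: "'m::finite \<Rightarrow> nat"
  assumes "CHAR('a::alg_closed_field) > 3"
    and "CARD('m) \<ge> 2"
    and "\<And>i. n i > 0"
  shows "\<not> one_and_half_generated op_scale op_bracket
             (S_alg_derived n :: ('m, 'a) dp_op set)"
proof
  assume gen: "one_and_half_generated op_scale op_bracket (S_alg_derived n :: ('m, 'a) dp_op set)"
  interpret truncated_dp n "\<lambda>i. CHAR('a) ^ n i - 1" "TYPE('a)"
    by unfold_locales (use assms in auto)
  obtain i j :: 'm where ij: "i \<noteq> j"
    using assms(2) card_le_Suc0_iff_eq[of "UNIV :: 'm set"] by fastforce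
  let ?x = "special_der n (\<lambda>l. if l = i then below_top j else if l = j then - below_top i else 0)"
  have "?x (dp_power (unit_index i)) = below_top j"
    using assms(1,3) by (subst special_der_variable) auto
  moreover have "below_top j \<noteq> 0"
    unfolding below_top_def using keys_dp_power by (metis insert_not_empty keys_zero)
  ultimately have "?x \<noteq> 0" by (metis zero_fun_apply)
  then obtain y where y: "y \<in> S_alg_derived n"
    "lie_generated op_scale op_bracket {?x, y} = S_alg_derived n"
    using gen top_field_in_S_alg_derived[OF ij] unfolding one_and_half_generated_def by blast
  obtain f where f: "\<And>k. f k \<in> A" "(\<Sum>k\<in>UNIV. dp_deriv k (f k)) = 0"
    "\<And>i. integral (dp_mult (X_top i) (f i)) = 0" and y_f: "y = special_der n f"
    using S_alg_derived_exact[OF y(1)] by blast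
  obtain h where "h \<in> A - constants" "vector_field f h = 0"
    using exists_nonconstant_invariant[OF f] by blast
  then obtain u where u: "u \<in> A" "u \<notin> constants" "vector_field f u = 0"
    "\<And>k. Poly_Mapping.lookup u (unit_index k) = 0"
    using exists_invariant_without_linear_part by blast
  have kills: "D u = 0" if "D \<in> S_alg_derived n" for D
  proof (rule lie_generated_annihilates[where D = D and X = "{?x, y}"])
    show "D \<in> lie_generated op_scale op_bracket {?x, y}" using that y(2) by simp
    show "E u = 0" if "E \<in> {?x, y}" for E
      using that u top_field_kills[OF ij u(1)] by (auto simp: special_der_eq y_f)
    show "E 0 = 0" if "E \<in> {?x, y}" for E
      using that by (auto simp: special_der_eq y_f vector_field.zero)
  qed
  have "dp_deriv k u = 0" for k
  proof -
    obtain l where "l \<noteq> k" using ij by metis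
    from kills[OF partial_in_S_alg_derived[OF this]] show ?thesis
      using u(1) by (simp add: special_der_eq vector_field_def if_distrib[of "\<lambda>f. dp_mult f _"]
          dp_mult_left.zero cong: if_cong)
  qed
  with u(2) show False
    using constant_if_derivs_zero by blast
qed

end
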